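(* Consider one of the three model settings (A), (B), (C) described in the context, with its associated function $\phi:\mathcal{D}\to\mathbb{R}$. Let $q$ be the number of global maximisers of $\phi$ over $\mathcal{D}$, and suppose $q<p$. Then every FIG-optimal design $\tilde{\mathbf{D}}$ is under-supported, having at most $q<p$ support points. Moreover, for every $\boldsymbol{\theta}\in\Theta$, the $n\times p$ matrix $M(\boldsymbol{\theta},\tilde{\mathbf{D}})$ has at most $q<p$ linearly independent rows, so it is rank deficient and the model is parameter redundant under $\tilde{\mathbf{D}}$.
   Context: There are $k$ controllable variables $\mathbf{d}=(d_1,\dots,d_k)^{T}\in\mathcal{D}\subseteq\mathbb{R}^k$. An experiment has a fixed number $n$ of runs; run $i$ uses $\mathbf{d}_i\in\mathcal{D}$ and yields a response $y_i$. The design is $\mathbf{D}=(\mathbf{d}_1^{T},\dots,\mathbf{d}_n^{T})^{T}\in\mathcal{D}^n$; the $\mathbf{d}_i$ are its design points and the distinct vectors among them are its support points. A design is under-supported if it has fewer than $p$ support points. The unknown parameter vector is $\boldsymbol{\theta}=(\theta_1,\dots,\theta_p)^{T}\in\Theta$, with $\Theta$ a $p$-dimensional parameter space, $p\le n$; the prior distribution of the parameters does not depend on $\mathbf{D}$. Exponential family model: given the parameters, $y_1,\dots,y_n$ are independent and $y_i$ has pdf or mass function $$\pi(y_i\vert\zeta_i,\gamma)=\exp\left(\frac{y_i\zeta_i-b(\zeta_i)-c_1(y_i)}{\gamma}-\frac12 a\left(-\frac1\gamma\right)+c_2(y_i)\right),$$ where $a,b,c_1,c_2$ are sufficiently smooth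 specified functions, $\gamma>0$ is a common scale parameter, and the natural parameter $\zeta_i$ depends on $\boldsymbol{\theta}$ and $\mathbf{d}_i$ through $b'(\zeta_i)=\mathrm{E}(y_i)=\mu(\boldsymbol{\theta},\mathbf{d}_i)$, with $\mu$ a given mean function, differentiable in $\boldsymbol{\theta}$; moreover $\mathrm{var}(y_i)=\gamma b''(\zeta_i)>0$. $M(\boldsymbol{\theta},\mathbf{D})$ is the $n\times p$ matrix with entries $M_{ij}(\boldsymbol{\theta},\mathbf{D})=\partial\mu(\boldsymbol{\theta},\mathbf{d}_i)/\partial\theta_j$. For exponential family models, parameter redundancy (the model can be re-expressed using fewer parameters) is characterised by, and here taken to mean, $M(\boldsymbol{\theta},\mathbf{D})$ being rank deficient, i.e. having rank less than $p$. The Fisher information matrix $\mathcal{I}$ is the expectation, over $\mathbf{y}$ given the parameters and $\mathbf{D}$, of the outer product of the gradient (with respect to the parameters) of the log likelihood with itself. The expected Fisher information gain $U_{FIG}(\mathbf{D})$ is the prior expectation of $\mathrm{tr}\,\mathcal{I}$; standard regularity conditions are assumed and these quantities are assumed to exist (be finite). A design is FIG-optimal if it maximises $U_{FIG}$ over $\mathcal{D}^n$. Settings: (A) $\gamma$ known; $\mathcal{I}$ is the $p\times p$ Fisher information for $\boldsymbol{\theta}$; $\phi(\mathbf{d})=\sum_{j=1}^p\mathrm{E}_{\boldsymbol{\theta}}\left[\frac{1}{\mathrm{var}_{y\vert\boldsymbol{\theta},\mathbf{d}}(y)}\left(\frac{\partial\mu(\boldsymbol{\theta},\mathbf{d})}{\partial\theta_j}\right)^2\right]$.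 (B) $\gamma$ unknown and of direct interest, with a prior on $(\boldsymbol{\theta},\gamma)$; $\mathcal{I}$ is the $(p+1)\times(p+1)$ Fisher information for $(\boldsymbol{\theta}^{T},\gamma)^{T}$; $\phi(\mathbf{d})=\sum_{j=1}^p\mathrm{E}_{\boldsymbol{\theta},\gamma}\left[\frac{1}{\mathrm{var}_{y\vert\boldsymbol{\theta},\gamma,\mathbf{d}}(y)}\left(\frac{\partial\mu(\boldsymbol{\theta},\mathbf{d})}{\partial\theta_j}\right)^2\right]$. (C) $y_i\sim\mathrm{N}(\mu(\boldsymbol{\theta},\mathbf{d}_i),\gamma)$ with $\gamma$ an unknown nuisance parameter having, independently of $\boldsymbol{\theta}$, an inverse-gamma prior with pdf $\pi(\gamma)=\frac{s_2^{s_1/2}}{2^{s_1/2}\Gamma(s_1/2)}\gamma^{-s_1/2-1}e^{-s_2/(2\gamma)}$, $s_1,s_2>0$; the likelihood is the marginal likelihood $\int_0^\infty\pi(\mathbf{y}\vert\boldsymbol{\theta},\gamma,\mathbf{D})\pi(\gamma)\,\mathrm{d}\gamma$ and $\mathcal{I}$ is the resulting $p\times p$ Fisher information for $\boldsymbol{\theta}$; $\phi(\mathbf{d})=\sum_{j=1}^p\mathrm{E}_{\boldsymbol{\theta}}\left[\left(\frac{\partial\mu(\boldsymbol{\theta},\mathbf{d})}{\partial\theta_j}\right)^2\right]$. Expectations $\mathrm{E}_{\boldsymbol{\theta}}$, $\mathrm{E}_{\boldsymbol{\theta},\gamma}$ are with respect to the prior. *)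

theory Defs
  imports "HOL-Probability.Probability"
begin

section \<open>Designs\<close>

text \<open>A design with \<open>n\<close> runs is a vector \<open>D :: real ^ 'k ^ 'n\<close>; its \<open>i\<close>-th design point is \<open>D $ i\<close>.\<close>

definition designs :: "(real ^ 'k) set \<Rightarrow> (real ^ 'k ^ 'n) set" where
  "designs \<D> = {D. \<forall>i. D $ i \<in> \<D>}"

definition support_points :: "real ^ 'k ^ 'n \<Rightarrow> (real ^ 'k) set" where
  "support_points D = range (\<lambda>i. D $ i)"

definition under_supported :: "nat \<Rightarrow> real ^ 'k ^ 'n \<Rightarrow> bool" where
  "under_supported p D \<longleftrightarrow> card (support_points D) < p"

definition global_maximisers :: "('d \<Rightarrow> real) \<Rightarrow> 'd set \<Rightarrow> 'd set" where
  "global_maximisers f S = {d. is_arg_max f (\<lambda>e. e \<in> S) d}"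

definition FIG_optimal :: "(real ^ 'k ^ 'n \<Rightarrow> real) \<Rightarrow> (real ^ 'k) set \<Rightarrow> real ^ 'k ^ 'n \<Rightarrow> bool" where
  "FIG_optimal U \<D> D \<longleftrightarrow> D \<in> global_maximisers U (designs \<D>)"


section \<open>Partial derivatives and Fisher information\<close>

definition partial_deriv :: "(real ^ 'm \<Rightarrow> real) \<Rightarrow> 'm \<Rightarrow> real ^ 'm \<Rightarrow> real" where
  "partial_deriv f j x = deriv (\<lambda>t. f (x + t *\<^sub>R axis j 1)) 0"

definition model_matrix :: "(real ^ 'p \<Rightarrow> real ^ 'k \<Rightarrow> real) \<Rightarrow> real ^ 'p \<Rightarrow> real ^ 'k ^ 'n \<Rightarrow> real ^ 'p ^ 'n"
  where "model_matrix \<mu> \<theta> D = (\<chi> i j. partial_deriv (\<lambda>t. \<mu> t (D $ i)) j \<theta>)"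

definition parameter_redundant ::
    "(real ^ 'p \<Rightarrow> real ^ 'k \<Rightarrow> real) \<Rightarrow> real ^ 'p \<Rightarrow> real ^ 'k ^ 'n \<Rightarrow> bool" where
  "parameter_redundant \<mu> \<theta> D \<longleftrightarrow> rank (model_matrix \<mu> \<theta> D) < CARD('p)"

text \<open>A likelihood \<open>L \<psi> y\<close> is a density of the response vector \<open>y\<close> with respect to a base
  measure \<open>N\<close>, given the parameter vector \<open>\<psi>\<close>.\<close>

definition score :: "(real ^ 'm \<Rightarrow> 'y \<Rightarrow> real) \<Rightarrow> real ^ 'm \<Rightarrow> 'y \<Rightarrow> real ^ 'm" where
  "score L \<psi> y = (\<chi> j. partial_deriv (\<lambda>\<psi>'. ln (L \<psi>' y)) j \<psi>)"

definition fisher_information ::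
    "'y measure \<Rightarrow> (real ^ 'm \<Rightarrow> 'y \<Rightarrow> real) \<Rightarrow> real ^ 'm \<Rightarrow> real ^ 'm ^ 'm" where
  "fisher_information N L \<psi> =
     (\<chi> i j. \<integral>y. score L \<psi> y $ i * score L \<psi> y $ j \<partial>density N (\<lambda>y. ennreal (L \<psi> y)))"

definition fisher_information_exists ::
    "'y measure \<Rightarrow> (real ^ 'm \<Rightarrow> 'y \<Rightarrow> real) \<Rightarrow> real ^ 'm \<Rightarrow> bool" where
  "fisher_information_exists N L \<psi> \<longleftrightarrow>
     (\<forall>i j. integrable (density N (\<lambda>y. ennreal (L \<psi> y)))
              (\<lambda>y. score L \<psi> y $ i * score L \<psi> y $ j))"


section \<open>Exponential family models\<close>

text \<open>\<open>nat_space\<close> is the range of admissible natural parameters. The density is a pdf on a Borel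
  set of responses or a mass function on a countable one, according to \<open>base\<close>.\<close>

record exp_family =
  base :: "real measure"
  a_fun :: "real \<Rightarrow> real"
  b_fun :: "real \<Rightarrow> real"
  c1_fun :: "real \<Rightarrow> real"
  c2_fun :: "real \<Rightarrow> real"
  nat_space :: "real set"

definition pdf_or_pmf_base :: "real measure \<Rightarrow> bool" where
  "pdf_or_pmf_base \<nu> \<longleftrightarrow>
     (\<exists>Y \<in> sets borel. \<nu> = restrict_space lborel Y) \<or> (\<exists>Y. countable Y \<and> \<nu> = count_space Y)"

definition ef_density :: "exp_family \<Rightarrow> real \<Rightarrow> real \<Rightarrow> real \<Rightarrow> real" where
  "ef_density F \<gamma> z y =
     exp ((y * z - b_fun F z - c1_fun F y) / \<gamma> - 1 / 2 * a_fun F (- 1 / \<gamma>) + c2_fun F y)"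

definition ef_response :: "exp_family \<Rightarrow> real \<Rightarrow> real \<Rightarrow> real measure" where
  "ef_response F \<gamma> z = density (base F) (\<lambda>y. ennreal (ef_density F \<gamma> z y))"

definition ef_var :: "exp_family \<Rightarrow> real \<Rightarrow> real \<Rightarrow> real" where
  "ef_var F \<gamma> z = prob_space.variance (ef_response F \<gamma> z) (\<lambda>y. y)"

text \<open>The model at a given scale \<open>\<gamma>\<close>. Only one value of \<open>\<gamma>\<close> is involved, because for some
  families (e.g. Bernoulli) the density is normalised only for \<open>\<gamma> = 1\<close>. Measurability is all
  that is required of \<open>c\<^sub>1\<close> and \<open>c\<^sub>2\<close>.\<close>

definition exp_family_at :: "exp_family \<Rightarrow> real \<Rightarrow> bool" where
  "exp_family_at F \<gamma> \<longleftrightarrow>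
     \<gamma> > 0 \<and>
     pdf_or_pmf_base (base F) \<and>
     c1_fun F \<in> borel_measurable (base F) \<and>
     c2_fun F \<in> borel_measurable (base F) \<and>
     (\<forall>s<0. a_fun F differentiable at s) \<and>
     open (nat_space F) \<and> is_interval (nat_space F) \<and>
     (\<forall>z \<in> nat_space F.
        b_fun F differentiable at z \<and> deriv (b_fun F) differentiable at z \<and>
        prob_space (ef_response F \<gamma> z) \<and>
        integrable (ef_response F \<gamma> z) (\<lambda>y. y) \<and>
        integrable (ef_response F \<gamma> z) (\<lambda>y. y\<^sup>2) \<and>
        prob_space.expectation (ef_response F \<gamma> z) (\<lambda>y. y) = deriv (b_fun F) z \<and>
        ef_var F \<gamma> z = \<gamma> * deriv (deriv (b_fun F)) z \<and>
        ef_var F \<gamma> z > 0)"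

definition mean_link ::
    "exp_family \<Rightarrow> (real ^ 'p) set \<Rightarrow> (real ^ 'k) set \<Rightarrow> (real ^ 'p \<Rightarrow> real ^ 'k \<Rightarrow> real) \<Rightarrow>
     (real ^ 'p \<Rightarrow> real ^ 'k \<Rightarrow> real) \<Rightarrow> bool" where
  "mean_link F \<Theta> \<D> \<mu> \<zeta> \<longleftrightarrow>
     (\<forall>\<theta>\<in>\<Theta>. \<forall>d\<in>\<D>. \<zeta> \<theta> d \<in> nat_space F \<and> deriv (b_fun F) (\<zeta> \<theta> d) = \<mu> \<theta> d)"

definition ef_base :: "exp_family \<Rightarrow> ('n \<Rightarrow> real) measure" where
  "ef_base F = (\<Pi>\<^sub>M i\<in>UNIV. base F)"

definition ef_likelihood ::
    "exp_family \<Rightarrow> (real ^ 'p \<Rightarrow> real ^ 'k \<Rightarrow> real) \<Rightarrow> real ^ 'k ^ 'n \<Rightarrow> real \<Rightarrow> real ^ 'p \<Rightarrow>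
     ('n \<Rightarrow> real) \<Rightarrow> real" where
  "ef_likelihood F \<zeta> D \<gamma> \<theta> y = (\<Prod>i\<in>UNIV. ef_density F \<gamma> (\<zeta> \<theta> (D $ i)) (y i))"

definition info_term ::
    "exp_family \<Rightarrow> (real ^ 'p \<Rightarrow> real ^ 'k \<Rightarrow> real) \<Rightarrow> (real ^ 'p \<Rightarrow> real ^ 'k \<Rightarrow> real) \<Rightarrow> real \<Rightarrow>
     real ^ 'k \<Rightarrow> 'p \<Rightarrow> real ^ 'p \<Rightarrow> real" where
  "info_term F \<mu> \<zeta> \<gamma> d j \<theta> =
     1 / ef_var F \<gamma> (\<zeta> \<theta> d) * (partial_deriv (\<lambda>t. \<mu> t d) j \<theta>)\<^sup>2"


section \<open>Priors\<close>

definition prior_on :: "'a::topological_space set \<Rightarrow> 'a measure \<Rightarrow> bool" where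
  "prior_on S P \<longleftrightarrow> prob_space P \<and> sets P = sets borel \<and> (AE x in P. x \<in> S)"

definition inverse_gamma_density :: "real \<Rightarrow> real \<Rightarrow> real \<Rightarrow> real" where
  "inverse_gamma_density s1 s2 \<gamma> =
     s2 powr (s1 / 2) / (2 powr (s1 / 2) * Gamma (s1 / 2)) *
     \<gamma> powr (- s1 / 2 - 1) * exp (- s2 / (2 * \<gamma>))"


section \<open>Setting A: known scale\<close>

definition FIG_A ::
    "exp_family \<Rightarrow> (real ^ 'p \<Rightarrow> real ^ 'k \<Rightarrow> real) \<Rightarrow> real \<Rightarrow> (real ^ 'p) measure \<Rightarrow>
     real ^ 'k ^ 'n \<Rightarrow> real" where
  "FIG_A F \<zeta> \<gamma> P D =
     (\<integral>\<theta>. trace (fisher_information (ef_base F) (ef_likelihood F \<zeta> D \<gamma>) \<theta>) \<partial>P)"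

definition phi_A ::
    "exp_family \<Rightarrow> (real ^ 'p \<Rightarrow> real ^ 'k \<Rightarrow> real) \<Rightarrow> (real ^ 'p \<Rightarrow> real ^ 'k \<Rightarrow> real) \<Rightarrow> real \<Rightarrow>
     (real ^ 'p) measure \<Rightarrow> real ^ 'k \<Rightarrow> real" where
  "phi_A F \<mu> \<zeta> \<gamma> P d = (\<Sum>j\<in>UNIV. \<integral>\<theta>. info_term F \<mu> \<zeta> \<gamma> d j \<theta> \<partial>P)"

definition setting_A ::
    "(real ^ 'p) set \<Rightarrow> (real ^ 'k) set \<Rightarrow> (real ^ 'p \<Rightarrow> real ^ 'k \<Rightarrow> real) \<Rightarrow> exp_family \<Rightarrow>
     (real ^ 'p \<Rightarrow> real ^ 'k \<Rightarrow> real) \<Rightarrow> real \<Rightarrow> (real ^ 'p) measure \<Rightarrow>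
     (real ^ 'k ^ 'n \<Rightarrow> real) \<Rightarrow> (real ^ 'k \<Rightarrow> real) \<Rightarrow> bool" where
  "setting_A \<Theta> \<D> \<mu> F \<zeta> \<gamma> P U \<phi> \<longleftrightarrow>
     exp_family_at F \<gamma> \<and> mean_link F \<Theta> \<D> \<mu> \<zeta> \<and> prior_on \<Theta> P \<and>
     U = FIG_A F \<zeta> \<gamma> P \<and> \<phi> = phi_A F \<mu> \<zeta> \<gamma> P \<and>
     (\<forall>D \<in> (designs \<D> :: (real ^ 'k ^ 'n) set).
        (\<forall>\<theta>\<in>\<Theta>. fisher_information_exists (ef_base F) (ef_likelihood F \<zeta> D \<gamma>) \<theta>) \<and>
        integrable P (\<lambda>\<theta>. trace (fisher_information (ef_base F) (ef_likelihood F \<zeta> D \<gamma>) \<theta>))) \<and>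
     (\<forall>d\<in>\<D>. \<forall>j. integrable P (info_term F \<mu> \<zeta> \<gamma> d j))"


section \<open>Setting B: unknown scale of direct interest\<close>

text \<open>The vector \<open>(\<theta>\<^sup>T, \<gamma>)\<^sup>T\<close> has index type \<open>'p option\<close>, which has \<open>p + 1\<close> elements:
  \<open>Some j\<close> is the position of \<open>\<theta>\<^sub>j\<close> and \<open>None\<close> that of \<open>\<gamma>\<close>.\<close>

definition join_par :: "real ^ ('p::finite) \<Rightarrow> real \<Rightarrow> real ^ (('p::finite) option)" where
  "join_par \<theta> \<gamma> = (\<chi> m. case m of None \<Rightarrow> \<gamma> | Some j \<Rightarrow> \<theta> $ j)"

definition theta_part :: "real ^ (('p::finite) option) \<Rightarrow> real ^ ('p::finite)" where
  "theta_part \<psi> = (\<chi> j. \<psi> $ Some j)"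

definition gamma_part :: "real ^ (('p::finite) option) \<Rightarrow> real" where
  "gamma_part \<psi> = \<psi> $ None"

definition joint_likelihood ::
    "exp_family \<Rightarrow> (real ^ ('p::finite) \<Rightarrow> real ^ 'k \<Rightarrow> real) \<Rightarrow> real ^ 'k ^ 'n \<Rightarrow> real ^ (('p::finite) option) \<Rightarrow>
     ('n \<Rightarrow> real) \<Rightarrow> real" where
  "joint_likelihood F \<zeta> D \<psi> = ef_likelihood F \<zeta> D (gamma_part \<psi>) (theta_part \<psi>)"

definition FIG_B ::
    "exp_family \<Rightarrow> (real ^ 'p \<Rightarrow> real ^ 'k \<Rightarrow> real) \<Rightarrow> ((real ^ 'p) \<times> real) measure \<Rightarrow>
     real ^ 'k ^ 'n \<Rightarrow> real" where
  "FIG_B F \<zeta> P D =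
     (\<integral>(\<theta>, \<gamma>). trace (fisher_information (ef_base F) (joint_likelihood F \<zeta> D) (join_par \<theta> \<gamma>)) \<partial>P)"

definition phi_B ::
    "exp_family \<Rightarrow> (real ^ 'p \<Rightarrow> real ^ 'k \<Rightarrow> real) \<Rightarrow> (real ^ 'p \<Rightarrow> real ^ 'k \<Rightarrow> real) \<Rightarrow>
     ((real ^ 'p) \<times> real) measure \<Rightarrow> real ^ 'k \<Rightarrow> real" where
  "phi_B F \<mu> \<zeta> P d = (\<Sum>j\<in>UNIV. \<integral>(\<theta>, \<gamma>). info_term F \<mu> \<zeta> \<gamma> d j \<theta> \<partial>P)"

definition setting_B ::
    "(real ^ 'p) set \<Rightarrow> (real ^ 'k) set \<Rightarrow> (real ^ 'p \<Rightarrow> real ^ 'k \<Rightarrow> real) \<Rightarrow> exp_family \<Rightarrow>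
     (real ^ 'p \<Rightarrow> real ^ 'k \<Rightarrow> real) \<Rightarrow> ((real ^ 'p) \<times> real) measure \<Rightarrow>
     (real ^ 'k ^ 'n \<Rightarrow> real) \<Rightarrow> (real ^ 'k \<Rightarrow> real) \<Rightarrow> bool" where
  "setting_B \<Theta> \<D> \<mu> F \<zeta> P U \<phi> \<longleftrightarrow>
     (\<forall>\<gamma>>0. exp_family_at F \<gamma>) \<and> mean_link F \<Theta> \<D> \<mu> \<zeta> \<and> prior_on (\<Theta> \<times> {0<..}) P \<and>
     U = FIG_B F \<zeta> P \<and> \<phi> = phi_B F \<mu> \<zeta> P \<and>
     (\<forall>D \<in> (designs \<D> :: (real ^ 'k ^ 'n) set).
        (\<forall>\<theta>\<in>\<Theta>. \<forall>\<gamma>>0.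
           fisher_information_exists (ef_base F) (joint_likelihood F \<zeta> D) (join_par \<theta> \<gamma>)) \<and>
        integrable P (\<lambda>(\<theta>, \<gamma>).
          trace (fisher_information (ef_base F) (joint_likelihood F \<zeta> D) (join_par \<theta> \<gamma>)))) \<and>
     (\<forall>d\<in>\<D>. \<forall>j. integrable P (\<lambda>(\<theta>, \<gamma>). info_term F \<mu> \<zeta> \<gamma> d j \<theta>))"


section \<open>Setting C: normal responses with an unknown nuisance variance\<close>

definition normal_base :: "('n \<Rightarrow> real) measure" where
  "normal_base = (\<Pi>\<^sub>M i\<in>UNIV. lborel)"

text \<open>Note that \<open>normal_density\<close> takes the standard deviation, whereas \<open>\<gamma>\<close> is the variance.\<close>

definition normal_likelihood ::
    "(real ^ 'p \<Rightarrow> real ^ 'k \<Rightarrow> real) \<Rightarrow> real ^ 'k ^ 'n \<Rightarrow> real \<Rightarrow> real ^ 'p \<Rightarrow> ('n \<Rightarrow> real) \<Rightarrow> real" where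
  "normal_likelihood \<mu> D \<gamma> \<theta> y = (\<Prod>i\<in>UNIV. normal_density (\<mu> \<theta> (D $ i)) (sqrt \<gamma>) (y i))"

definition marginal_likelihood ::
    "(real ^ 'p \<Rightarrow> real ^ 'k \<Rightarrow> real) \<Rightarrow> real \<Rightarrow> real \<Rightarrow> real ^ 'k ^ 'n \<Rightarrow> real ^ 'p \<Rightarrow>
     ('n \<Rightarrow> real) \<Rightarrow> real" where
  "marginal_likelihood \<mu> s1 s2 D \<theta> y =
     (LINT \<gamma>:{0<..}|lborel. normal_likelihood \<mu> D \<gamma> \<theta> y * inverse_gamma_density s1 s2 \<gamma>)"

definition FIG_C ::
    "(real ^ 'p \<Rightarrow> real ^ 'k \<Rightarrow> real) \<Rightarrow> real \<Rightarrow> real \<Rightarrow> (real ^ 'p) measure \<Rightarrow>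
     real ^ 'k ^ 'n \<Rightarrow> real" where
  "FIG_C \<mu> s1 s2 P D =
     (\<integral>\<theta>. trace (fisher_information normal_base (marginal_likelihood \<mu> s1 s2 D) \<theta>) \<partial>P)"

definition phi_C ::
    "(real ^ 'p \<Rightarrow> real ^ 'k \<Rightarrow> real) \<Rightarrow> (real ^ 'p) measure \<Rightarrow> real ^ 'k \<Rightarrow> real" where
  "phi_C \<mu> P d = (\<Sum>j\<in>UNIV. \<integral>\<theta>. (partial_deriv (\<lambda>t. \<mu> t d) j \<theta>)\<^sup>2 \<partial>P)"

definition setting_C ::
    "(real ^ 'p) set \<Rightarrow> (real ^ 'k) set \<Rightarrow> (real ^ 'p \<Rightarrow> real ^ 'k \<Rightarrow> real) \<Rightarrow> real \<Rightarrow> real \<Rightarrow>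
     (real ^ 'p) measure \<Rightarrow> (real ^ 'k ^ 'n \<Rightarrow> real) \<Rightarrow> (real ^ 'k \<Rightarrow> real) \<Rightarrow> bool" where
  "setting_C \<Theta> \<D> \<mu> s1 s2 P U \<phi> \<longleftrightarrow>
     s1 > 0 \<and> s2 > 0 \<and> prior_on \<Theta> P \<and>
     U = FIG_C \<mu> s1 s2 P \<and> \<phi> = phi_C \<mu> P \<and>
     (\<forall>D \<in> (designs \<D> :: (real ^ 'k ^ 'n) set).
        (\<forall>\<theta>\<in>\<Theta>. fisher_information_exists normal_base (marginal_likelihood \<mu> s1 s2 D) \<theta>) \<and>
        integrable P (\<lambda>\<theta>. trace (fisher_information normal_base (marginal_likelihood \<mu> s1 s2 D) \<theta>))) \<and>
     (\<forall>d\<in>\<D>. \<forall>j. integrable P (\<lambda>\<theta>. (partial_deriv (\<lambda>t. \<mu> t d) j \<theta>)\<^sup>2))"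

end

theory Submission
  imports Defs
begin

text \<open>
  In each setting the expected information gain of a design is, up to a term that is the same for
  all designs, a positive combination of the values of \<open>\<phi>\<close> at the runs:
  \<open>U D' - U D = (\<Sum>i. c i * (\<phi> (D' $ i) - \<phi> (D $ i)))\<close> with \<open>c i > 0\<close>. The runs are therefore chosen
  independently of each other, and replacing a single run by a better point would improve an
  optimal design; so every run of an optimal design maximises \<open>\<phi>\<close>
  (\<open>FIG_optimal_support_points\<close>). There are only \<open>q\<close> such points, and a row of the model matrix is
  determined by the design point of its run, which bounds the number of distinct rows and the rank.

  The identity for \<open>U\<close> comes from the trace of the Fisher information, computed separately in the
  three settings.

  In a regular exponential family, \<open>b'\<close> is strictly increasing, so the equation \<open>b' \<zeta> = \<mu>\<close> makes \<open>\<zeta>\<close>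
  a differentiable function of the parameters, and the score for \<open>\<theta>\<^sub>j\<close> is a sum over the runs of
  independent centred terms \<open>(y i - \<mu> i) * \<partial>\<^sub>j \<mu> i / var i\<close>. Its second moment is the sum of their
  variances, that is, of the integrands of \<open>\<phi>\<close> (\<open>theta_information\<close>).

  When the scale is a parameter too, the trace has one more entry. Normalisation of the density for
  all scales says that \<open>T = y * \<zeta> - b \<zeta> - c\<^sub>1 y\<close> has a moment generating function determined by \<open>a\<close>
  and the scale alone. The first two moments of \<open>T\<close> thus do not depend on \<open>\<zeta>\<close>, and neither does the additional
  entry depend on the design (\<open>scale_information\<close>).

  For normal responses whose variance is integrated out, the likelihood is a constant times
  \<open>(s\<^sub>2 + |y - \<mu>|\<^sup>2) powr (- (s\<^sub>1 + n) / 2)\<close>, a multivariate Student density. The score is a linear form in the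
  residuals divided by \<open>s\<^sub>2 + |y - \<mu>|\<^sup>2\<close>. Reflecting one residual shows that mixed moments vanish, so
  that the trace is a combination of the squared derivatives with positive coefficients that do not
  depend on \<open>\<theta>\<close> or on the design (\<open>trace_information_C\<close>).
\<close>


section \<open>Optimal designs and the rank of the model matrix\<close>

text \<open>Only one run is exchanged: the difference in gain then reduces to the single summand of
  that run, whose sign is that of the change in \<open>\<phi>\<close>.\<close>

lemma FIG_optimal_support_points:
  fixes U :: "real ^ 'k ^ 'n \<Rightarrow> real"
  assumes opt: "FIG_optimal U \<D> D"
    and c: "\<And>i. c i > 0"
    and gain: "\<And>D D'. D \<in> designs \<D> \<Longrightarrow> D' \<in> designs \<D> \<Longrightarrow>
      U D' - U D = (\<Sum>i\<in>UNIV. c i * (\<phi> (D' $ i) - \<phi> (D $ i)))"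
  shows "support_points D \<subseteq> global_maximisers \<phi> \<D>"
proof
  fix d assume "d \<in> support_points D"
  then obtain i where d: "d = D $ i"
    by (auto simp: support_points_def)
  have D: "D \<in> designs \<D>" and max: "\<And>D'. D' \<in> designs \<D> \<Longrightarrow> U D' \<le> U D"
    using opt by (force simp: FIG_optimal_def global_maximisers_def is_arg_max_def)+
  have "\<phi> e \<le> \<phi> (D $ i)" if e: "e \<in> \<D>" for e
  proof -
    define D' where "D' = (\<chi> l. if l = i then e else D $ l)"
    have D': "D' \<in> designs \<D>"
      using D e by (simp add: D'_def designs_def)
    have "(\<Sum>l\<in>UNIV. c l * (\<phi> (D' $ l) - \<phi> (D $ l))) =
        (\<Sum>l\<in>UNIV. if l = i then c i * (\<phi> e - \<phi> (D $ i)) else 0)"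
      by (rule sum.cong) (auto simp: D'_def)
    hence "c i * (\<phi> e - \<phi> (D $ i)) \<le> 0"
      using gain[OF D D'] max[OF D'] by simp
    thus ?thesis
      using c[of i] by (simp add: mult_le_0_iff)
  qed
  moreover have "D $ i \<in> \<D>"
    using D by (simp add: designs_def)
  ultimately show "d \<in> global_maximisers \<phi> \<D>"
    by (force simp: d global_maximisers_def is_arg_max_def)
qed

lemma finite_support_points: "finite (support_points D)"
  by (simp add: support_points_def)

lemma finite_rows_model_matrix: "finite (rows (model_matrix \<mu> \<theta> D))"
  by (simp add: rows_def full_SetCompr_eq)

text \<open>Runs at the same design point give equal rows.\<close>

lemma card_rows_model_matrix:
  "card (rows (model_matrix \<mu> \<theta> D)) \<le> card (support_points D)"
proof -
  have "rows (model_matrix \<mu> \<theta> D) =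
      (\<lambda>d. \<chi> j. partial_deriv (\<lambda>t. \<mu> t d) j \<theta>) ` support_points D"
    by (auto simp: rows_def row_def model_matrix_def support_points_def)
  thus ?thesis
    by (simp add: card_image_le finite_support_points)
qed

lemma rank_model_matrix: "rank (model_matrix \<mu> \<theta> D) \<le> card (support_points D)"
proof -
  have "rank (model_matrix \<mu> \<theta> D) \<le> card (rows (model_matrix \<mu> \<theta> D))"
    unfolding row_rank_def by (rule dim_le_card[OF span_superset finite_rows_model_matrix])
  thus ?thesis
    using card_rows_model_matrix le_trans by blast
qed

lemma card_subset_rows_model_matrix:
  "R \<subseteq> rows (model_matrix \<mu> \<theta> D) \<Longrightarrow> card R \<le> card (support_points D)"
  using card_mono[OF finite_rows_model_matrix] card_rows_model_matrix le_trans by blast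


section \<open>Product measures\<close>

lemma PiM_density:
  fixes M :: "'i::finite \<Rightarrow> 'a measure"
  assumes sf: "\<And>i. sigma_finite_measure (M i)"
    and g: "\<And>i. g i \<in> borel_measurable (M i)"
    and sf': "\<And>i. sigma_finite_measure (density (M i) (g i))"
  shows "density (PiM UNIV M) (\<lambda>y. \<Prod>i\<in>UNIV. g i (y i)) = PiM UNIV (\<lambda>i. density (M i) (g i))"
proof -
  interpret M: product_sigma_finite M by (unfold_locales) (use sf in \<open>auto simp: sigma_finite_measure_def\<close>)
  interpret N: product_sigma_finite "\<lambda>i. density (M i) (g i)"
    by (unfold_locales) (use sf' in \<open>auto simp: sigma_finite_measure_def\<close>)
  note g[measurable]
  show ?thesis
  proof (rule N.PiM_eqI)
    show "sets (density (PiM UNIV M) (\<lambda>y. \<Prod>i\<in>UNIV. g i (y i))) = sets (PiM UNIV (\<lambda>i. density (M i) (g i)))"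
      by (simp cong: sets_PiM_cong)
    fix A assume "\<And>i. i \<in> UNIV \<Longrightarrow> A i \<in> sets (density (M i) (g i))"
    hence A[measurable]: "A i \<in> sets (M i)" for i by auto
    have "Pi\<^sub>E UNIV A \<in> sets (PiM UNIV M)" 
      by (rule sets_PiM_I_finite) (auto intro: A)
    hence "emeasure (density (PiM UNIV M) (\<lambda>y. \<Prod>i\<in>UNIV. g i (y i))) (Pi\<^sub>E UNIV A) =
      (\<integral>\<^sup>+y. (\<Prod>i\<in>UNIV. g i (y i)) * indicator (Pi\<^sub>E UNIV A) y \<partial>PiM UNIV M)"
      by (intro emeasure_density) auto
    also have "\<dots> = (\<integral>\<^sup>+y. (\<Prod>i\<in>UNIV. g i (y i) * indicator (A i) (y i)) \<partial>PiM UNIV M)"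
    proof (rule nn_integral_cong)
      fix y assume "y \<in> space (PiM UNIV M)"
      have "indicator (Pi\<^sub>E UNIV A) y = (\<Prod>i\<in>UNIV. indicator (A i) (y i) :: ennreal)"
        by (auto simp: indicator_def PiE_def Pi_def)
      thus "(\<Prod>i\<in>UNIV. g i (y i)) * indicator (Pi\<^sub>E UNIV A) y = (\<Prod>i\<in>UNIV. g i (y i) * indicator (A i) (y i))"
        by (simp add: prod.distrib)
    qed
    also have "\<dots> = (\<Prod>i\<in>UNIV. \<integral>\<^sup>+x. g i x * indicator (A i) x \<partial>M i)"
      by (rule M.product_nn_integral_prod) auto
    also have "\<dots> = (\<Prod>i\<in>UNIV. emeasure (density (M i) (g i)) (A i))"
      by (intro prod.cong refl emeasure_density[symmetric]) auto
    finally show "emeasure (density (PiM UNIV M) (\<lambda>y. \<Prod>i\<in>UNIV. g i (y i))) (Pi\<^sub>E UNIV A) = \<dots>" .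
  qed auto
qed

text \<open>Independence turns the mixed moments into products of means. The terms need not be centred: the
  score for the scale is treated by observing that every mean and second moment on the right is the
  same for all designs.\<close>

lemma integral_square_sum_PiM:
  fixes N :: "'i::finite \<Rightarrow> 'a measure" and X :: "'i \<Rightarrow> 'a \<Rightarrow> real"
  assumes prob: "\<And>i. prob_space (N i)"
    and int1: "\<And>i. integrable (N i) (X i)"
    and int2: "\<And>i. integrable (N i) (\<lambda>x. (X i x)\<^sup>2)"
  shows "(\<integral>y. (\<Sum>i\<in>UNIV. X i (y i))\<^sup>2 \<partial>PiM UNIV N) =
    (\<Sum>i\<in>UNIV. \<Sum>k\<in>UNIV. if i = k then \<integral>x. (X i x)\<^sup>2 \<partial>N i else (\<integral>x. X i x \<partial>N i) * (\<integral>x. X k x \<partial>N k))"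
proof -
  interpret prob_space "N i" for i by (rule prob)
  interpret product_prob_space N UNIV by unfold_locales
  have moment: "integrable (PiM UNIV N) (\<lambda>y. X i (y i) * X k (y k)) \<and>
      (\<integral>y. X i (y i) * X k (y k) \<partial>PiM UNIV N) =
      (if i = k then \<integral>x. (X i x)\<^sup>2 \<partial>N i else (\<integral>x. X i x \<partial>N i) * (\<integral>x. X k x \<partial>N k))" for i k
  proof -
    \<comment> \<open>A product over all coordinates whose factors are \<open>1\<close> off \<open>i\<close> and \<open>k\<close>; for \<open>i = k\<close> both
      conditions hold at once and the factor is the square.\<close>
    define f where "f l x = (if l = i then X i x else 1) * (if l = k then X k x else 1)" for l x
    have f: "(\<Prod>l\<in>UNIV. f l (y l)) = X i (y i) * X k (y k)" for y
      by (simp add: f_def prod.distrib)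
    have int: "integrable (N l) (f l)" for l
      using int1[of l] int2[of l] unfolding f_def[abs_def]
      by (cases "l = i"; cases "l = k") (simp_all add: power2_eq_square)
    have "(\<Prod>l\<in>UNIV. integral\<^sup>L (N l) (f l)) = (\<Prod>l\<in>{i,k}. integral\<^sup>L (N l) (f l))"
      by (rule prod.mono_neutral_right) (auto simp: f_def[abs_def] prob_space.prob_space[OF prob])
    also have "\<dots> = (if i = k then \<integral>x. (X i x)\<^sup>2 \<partial>N i else (\<integral>x. X i x \<partial>N i) * (\<integral>x. X k x \<partial>N k))"
      by (auto simp: f_def[abs_def] power2_eq_square)
    finally show ?thesis
      using product_integrable_prod[of UNIV f] product_integral_prod[of UNIV f] int
      by (simp add: f)
  qed
  have "(\<integral>y. (\<Sum>i\<in>UNIV. X i (y i))\<^sup>2 \<partial>PiM UNIV N) =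
      (\<integral>y. (\<Sum>i\<in>UNIV. \<Sum>k\<in>UNIV. X i (y i) * X k (y k)) \<partial>PiM UNIV N)"
    by (simp add: power2_eq_square sum_product)
  also have "\<dots> = (\<Sum>i\<in>UNIV. \<Sum>k\<in>UNIV. \<integral>y. X i (y i) * X k (y k) \<partial>PiM UNIV N)"
    using moment by (simp add: Bochner_Integration.integral_sum)
  finally show ?thesis
    using moment by simp
qed


section \<open>Moments from the moment generating function\<close>

lemma abs_exp_minus_one_le: "\<bar>exp u - 1\<bar> \<le> \<bar>u\<bar> * exp \<bar>u :: real\<bar>"
proof (cases "u \<ge> 0")
  case True
  have "1 - u \<le> exp (- u)" using exp_ge_add_one_self[of "-u"] by simp
  hence "exp u * (1 - u) \<le> exp u * exp (-u)" by (intro mult_left_mono) auto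
  thus ?thesis using True by (simp add: exp_minus algebra_simps)
next
  case False
  have "-u * 1 \<le> -u * exp (-u)"
    using False by (intro mult_left_mono) auto
  moreover have "\<bar>exp u - 1\<bar> \<le> - u * 1"
    using False exp_ge_add_one_self[of u] exp_le_one_iff[of u] by linarith
  moreover have "-u * exp (-u) = \<bar>u\<bar> * exp \<bar>u\<bar>"
    using False by simp
  ultimately show ?thesis by linarith
qed

lemma exp_abs_le: "exp (c * \<bar>x\<bar>) \<le> exp (c * x) + exp (- c * x :: real)"
  by (cases "x \<ge> 0") auto

text \<open>The first two moments are limits of the first and second difference quotients of the moment
  generating function at \<open>0\<close>. In this form they can be read off from \<open>G\<close>, so that two statistics with
  the same moment generating function near \<open>0\<close> have the same moments. Below \<open>\<delta> / 8\<close>, the quotients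
  are dominated by multiples of \<open>exp (5 * (\<delta> / 8) * \<bar>X x\<bar>)\<close>, which is integrable.\<close>

lemma moments_from_mgf:
  fixes X :: "'a \<Rightarrow> real"
  assumes X[measurable]: "X \<in> borel_measurable M" and "\<delta> > 0"
    and int: "\<And>h. \<bar>h\<bar> < \<delta> \<Longrightarrow> integrable M (\<lambda>x. exp (h * X x))"
    and s_pos: "\<And>n. 0 < s n" and s_le: "\<And>n. s n \<le> \<delta> / 8" and s0: "s \<longlonglongrightarrow> 0"
    and G: "\<And>h. \<bar>h\<bar> < \<delta> \<Longrightarrow> (\<integral>x. exp (h * X x) \<partial>M) = G h"
  shows "integrable M X" "integrable M (\<lambda>x. (X x)\<^sup>2)"
    "(\<lambda>n. (G (s n) - G 0) / s n) \<longlonglongrightarrow> (\<integral>x. X x \<partial>M)"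
    "(\<lambda>n. (G (s n) - 2 * G 0 + G (- s n)) / (s n)\<^sup>2) \<longlonglongrightarrow> (\<integral>x. (X x)\<^sup>2 \<partial>M)"
proof -
  define c where "c = \<delta> / 8"
  have c: "c > 0" using \<open>\<delta> > 0\<close> by (simp add: c_def)
  have s: "s n > 0" "s n \<le> c" "s n < \<delta>" for n
    using s_pos[of n] s_le[of n] \<open>\<delta> > 0\<close> unfolding c_def by linarith+
  have int_abs: "integrable M (\<lambda>x. exp (k * c * \<bar>X x\<bar>))" if "0 < k" "k < 8" for k
  proof (rule Bochner_Integration.integrable_bound)
    show "integrable M (\<lambda>x. exp (k * c * X x) + exp (- (k * c) * X x))"
      using that \<open>\<delta> > 0\<close> by (intro Bochner_Integration.integrable_add int) (auto simp: c_def abs_mult)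
    show "AE x in M. norm (exp (k * c * \<bar>X x\<bar>)) \<le> norm (exp (k * c * X x) + exp (- (k * c) * X x))"
    proof (rule AE_I2)
      fix x
      show "norm (exp (k * c * \<bar>X x\<bar>)) \<le> norm (exp (k * c * X x) + exp (- (k * c) * X x))"
        using exp_abs_le[of "k * c" "X x"] by (simp add: order_trans[OF _ abs_ge_self])
    qed
  qed measurable
  \<comment> \<open>The second difference quotient of \<open>h \<mapsto> exp (h * X x)\<close> is \<open>exp (- h * X x)\<close> times the square of
    the first, which reduces its bound and its limit to those of \<open>f\<close>.\<close>
  define f where "f n x = (exp (s n * X x) - 1) / s n" for n x
  define g where "g n x = exp (- s n * X x) * (f n x)\<^sup>2" for n x
  have [measurable]: "f n \<in> borel_measurable M" "g n \<in> borel_measurable M" for n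
    by (auto simp: f_def[abs_def] g_def[abs_def])
  have f_le: "\<bar>f n x\<bar> \<le> exp (2 * c * \<bar>X x\<bar>) / c" for n x
  proof -
    have "\<bar>f n x\<bar> \<le> (\<bar>s n * X x\<bar> * exp \<bar>s n * X x\<bar>) / s n"
      unfolding f_def abs_divide using s[of n] abs_exp_minus_one_le[of "s n * X x"]
      by (auto intro!: divide_right_mono)
    also have "\<dots> = \<bar>X x\<bar> * exp (s n * \<bar>X x\<bar>)"
      using s(1)[of n] by (simp add: abs_mult)
    also have "\<dots> \<le> (exp (c * \<bar>X x\<bar>) / c) * exp (c * \<bar>X x\<bar>)"
    proof (rule mult_mono)
      have "c * \<bar>X x\<bar> \<le> exp (c * \<bar>X x\<bar>)"
        using exp_ge_add_one_self[of "c * \<bar>X x\<bar>"] by linarith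
      thus "\<bar>X x\<bar> \<le> exp (c * \<bar>X x\<bar>) / c"
        using c by (simp add: field_simps)
      show "exp (s n * \<bar>X x\<bar>) \<le> exp (c * \<bar>X x\<bar>)"
        using s(2)[of n] by (simp add: mult_right_mono)
    qed (use c in auto)
    also have "\<dots> = exp (2 * c * \<bar>X x\<bar>) / c"
      by (simp add: mult_exp_exp)
    finally show ?thesis .
  qed
  have g_le: "\<bar>g n x\<bar> \<le> exp (5 * c * \<bar>X x\<bar>) / c\<^sup>2" for n x
  proof -
    have "\<bar>s n * X x\<bar> \<le> c * \<bar>X x\<bar>"
      using s[of n] by (simp add: abs_mult mult_right_mono)
    hence "- s n * X x \<le> c * \<bar>X x\<bar>"
      by simp
    hence "\<bar>g n x\<bar> \<le> exp (c * \<bar>X x\<bar>) * (exp (2 * c * \<bar>X x\<bar>) / c)\<^sup>2"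
      unfolding g_def abs_mult using power_mono[OF f_le[of n x], of 2]
      by (intro mult_mono) auto
    also have "\<dots> = exp (5 * c * \<bar>X x\<bar>) / c\<^sup>2"
    proof -
      have "(exp (2 * c * \<bar>X x\<bar>))\<^sup>2 = exp (4 * c * \<bar>X x\<bar>)"
        by (simp add: power2_eq_square mult_exp_exp)
      thus ?thesis by (simp add: power_divide mult_exp_exp)
    qed
    finally show ?thesis .
  qed
  have f_lim: "(\<lambda>n. f n x) \<longlonglongrightarrow> X x" for x
  proof -
    have "((\<lambda>h. exp (h * X x)) has_real_derivative X x) (at 0)"
      by (auto intro!: derivative_eq_intros)
    hence "((\<lambda>h. (exp (h * X x) - 1) / h) \<longlongrightarrow> X x) (at 0)"
      by (simp add: DERIV_def)
    moreover have "filterlim s (at 0) sequentially"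
      using s0 s(1) by (auto simp: filterlim_at intro!: always_eventually less_imp_neq[symmetric])
    ultimately show ?thesis
      unfolding f_def by (rule filterlim_compose)
  qed
  have g_lim: "(\<lambda>n. g n x) \<longlonglongrightarrow> (X x)\<^sup>2" for x
  proof -
    have "(\<lambda>n. exp (- s n * X x) * (f n x)\<^sup>2) \<longlonglongrightarrow> exp (- 0 * X x) * (X x)\<^sup>2"
      by (intro tendsto_intros f_lim s0)
    thus ?thesis by (simp add: g_def)
  qed
  have w: "integrable M (\<lambda>x. exp (2 * c * \<bar>X x\<bar>) / c)" "integrable M (\<lambda>x. exp (5 * c * \<bar>X x\<bar>) / c\<^sup>2)"
    using int_abs[of 2] int_abs[of 5] by auto
  show "integrable M X"
    by (rule integrable_dominated_convergence[OF _ _ w(1), of _ f]) (use f_lim f_le in auto)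
  show "integrable M (\<lambda>x. (X x)\<^sup>2)"
    by (rule integrable_dominated_convergence[OF _ _ w(2), of _ g]) (use g_lim g_le in auto)
  have i: "integrable M (\<lambda>x. exp (s n * X x))" "integrable M (\<lambda>x. exp (- s n * X x))" for n
    using int[of "s n"] int[of "- s n"] s[of n] by auto
  have i1: "integrable M (\<lambda>x. a :: real)" for a
    using integrable_mult_right[OF int[of 0], of a] \<open>\<delta> > 0\<close> by simp
  have i0: "(\<integral>x. 1 \<partial>M) = G 0"
    using G[of 0] \<open>\<delta> > 0\<close> by simp
  have "(\<lambda>n. \<integral>x. f n x \<partial>M) \<longlonglongrightarrow> (\<integral>x. X x \<partial>M)"
    by (rule integral_dominated_convergence[OF _ _ w(1)]) (use f_lim f_le in auto)
  moreover have "(\<integral>x. f n x \<partial>M) = (G (s n) - G 0) / s n" for n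
    using i[of n] i1 i0 G[of "s n"] s[of n] by (simp add: f_def)
  ultimately show "(\<lambda>n. (G (s n) - G 0) / s n) \<longlonglongrightarrow> (\<integral>x. X x \<partial>M)"
    by simp
  have "(\<lambda>n. \<integral>x. g n x \<partial>M) \<longlonglongrightarrow> (\<integral>x. (X x)\<^sup>2 \<partial>M)"
    by (rule integral_dominated_convergence[OF _ _ w(2)]) (use g_lim g_le in auto)
  moreover have "(\<integral>x. g n x \<partial>M) = (G (s n) - 2 * G 0 + G (- s n)) / (s n)\<^sup>2" for n
  proof -
    have "g n x = (exp (s n * X x) - 2 * 1 + exp (- s n * X x)) / (s n)\<^sup>2" for x
    proof -
      have "exp (- s n * X x) * exp (s n * X x) = 1"
        by (simp add: mult_exp_exp)
      hence "exp (- s n * X x) * (exp (s n * X x) - 1)\<^sup>2 = exp (s n * X x) - 2 * 1 + exp (- s n * X x)"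
        by algebra
      thus ?thesis by (simp add: g_def f_def power_divide)
    qed
    thus ?thesis
      using i[of n] i1 i0 G[of "s n"] G[of "- s n"] s[of n] by simp
  qed
  ultimately show "(\<lambda>n. (G (s n) - 2 * G 0 + G (- s n)) / (s n)\<^sup>2) \<longlonglongrightarrow> (\<integral>x. (X x)\<^sup>2 \<partial>M)"
    by simp
qed


section \<open>Differentiation of implicit functions and along coordinate axes\<close>

text \<open>The function \<open>z\<close> is the composition of \<open>m\<close> with the inverse of the strictly increasing \<open>g\<close>.
  Monotonicity of \<open>g\<close> and continuity of \<open>m\<close> make it continuous at \<open>t0\<close>; its difference quotient is then that of \<open>m\<close>
  divided by the slope of \<open>g\<close> between \<open>z t0\<close> and \<open>z t\<close>, which tends to \<open>g' (z t0)\<close>.\<close>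

lemma has_real_derivative_implicit:
  fixes g z m :: "real \<Rightarrow> real"
  assumes I: "open I" "is_interval I"
    and g: "\<And>x. x \<in> I \<Longrightarrow> (g has_real_derivative g' x) (at x)" "\<And>x. x \<in> I \<Longrightarrow> g' x > 0"
    and z: "\<forall>\<^sub>F t in nhds t0. z t \<in> I \<and> g (z t) = m t"
    and m: "(m has_real_derivative m') (at t0)"
  shows "(z has_real_derivative m' / g' (z t0)) (at t0)"
proof -
  have mono: "g x < g y" if "x \<in> I" "y \<in> I" "x < y" for x y
  proof (rule DERIV_pos_imp_increasing[OF \<open>x < y\<close>])
    fix w assume "x \<le> w" "w \<le> y"
    with I(2) that have "w \<in> I" by (blast intro: mem_is_interval_1_I)
    thus "\<exists>d. (g has_real_derivative d) (at w) \<and> d > 0" using g by blast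
  qed
  have z0: "z t0 \<in> I" "g (z t0) = m t0"
    using z by (auto dest: eventually_nhds_x_imp_x)
  have z': "\<forall>\<^sub>F t in at t0. z t \<in> I \<and> g (z t) = m t"
    using z by (simp add: eventually_at_filter eventually_mono)
  have m_lim: "m \<midarrow>t0\<rightarrow> g (z t0)"
    using DERIV_isCont[OF m] z0 by (simp add: isCont_def)
  have z_lim: "z \<midarrow>t0\<rightarrow> z t0"
  proof (rule tendstoI)
    fix e :: real assume "e > 0"
    obtain r where r: "r > 0" "cball (z t0) r \<subseteq> I"
      using I(1) z0(1) open_contains_cball by blast
    define s where "s = min r (e / 2)"
    have s: "s > 0" "s < e" using r \<open>e > 0\<close> by (auto simp: s_def)
    have sI: "z t0 - s \<in> I" "z t0 + s \<in> I"
      using r s by (auto simp: s_def dist_real_def intro!: subsetD[OF r(2)])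
    have "g (z t0 - s) < g (z t0)" "g (z t0) < g (z t0 + s)"
      using mono[OF sI(1) z0(1)] mono[OF z0(1) sI(2)] s by auto
    hence "\<forall>\<^sub>F t in at t0. g (z t0 - s) < m t" "\<forall>\<^sub>F t in at t0. m t < g (z t0 + s)"
      using order_tendstoD[OF m_lim] by blast+
    with z' show "\<forall>\<^sub>F t in at t0. dist (z t) (z t0) < e"
    proof eventually_elim
      case (elim t)
      have "z t0 - s < z t"
        using elim mono[OF _ sI(1), of "z t"] by (cases "z t < z t0 - s") (auto simp: not_less order.order_iff_strict)
      moreover have "z t < z t0 + s"
        using elim mono[OF sI(2), of "z t"] by (cases "z t0 + s < z t") (auto simp: not_less order.order_iff_strict)
      ultimately show ?case
        using s by (auto simp: dist_real_def)
    qed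
  qed
  obtain h where h: "\<And>x. g x - g (z t0) = h x * (x - z t0)" "isCont h (z t0)" "h (z t0) = g' (z t0)"
    using g(1)[OF z0(1)] by (auto simp: CARAT_DERIV)
  have h_lim: "((\<lambda>t. h (z t)) \<longlongrightarrow> g' (z t0)) (at t0)"
    using isCont_tendsto_compose[OF h(2) z_lim] h(3) by simp
  have "g' (z t0) > 0" by (rule g(2)[OF z0(1)])
  have "((\<lambda>t. (m t - m t0) / (t - t0) / h (z t)) \<longlongrightarrow> m' / g' (z t0)) (at t0)"
    using m h_lim \<open>g' (z t0) > 0\<close> by (intro tendsto_divide) (auto simp: has_field_derivative_iff)
  moreover have "\<forall>\<^sub>F t in at t0. (m t - m t0) / (t - t0) / h (z t) = (z t - z t0) / (t - t0)"
    using z' order_tendstoD(1)[OF h_lim \<open>g' (z t0) > 0\<close>]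
  proof eventually_elim
    case (elim t)
    have "m t - m t0 = h (z t) * (z t - z t0)"
      using h(1)[of "z t"] elim z0 by simp
    thus ?case using elim by simp
  qed
  ultimately show ?thesis
    unfolding has_field_derivative_iff by (rule Lim_transform_eventually)
qed

lemma has_real_derivative_along_axis:
  fixes f :: "real ^ 'p \<Rightarrow> real"
  assumes "f differentiable (at \<theta>)"
  shows "((\<lambda>t. f (\<theta> + t *\<^sub>R axis j 1)) has_real_derivative partial_deriv f j \<theta>) (at 0)"
proof -
  have "(f \<circ> (\<lambda>t. \<theta> + t *\<^sub>R axis j 1)) differentiable (at 0)"
    using assms by (intro differentiable_chain_at) simp_all
  hence "(\<lambda>t. f (\<theta> + t *\<^sub>R axis j 1)) differentiable (at 0)"
    by (simp add: o_def)
  thus ?thesis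
    unfolding partial_deriv_def by (simp add: DERIV_deriv_iff_real_differentiable)
qed

lemma partial_deriv_eq:
  "((\<lambda>t. f (\<theta> + t *\<^sub>R axis j 1)) has_real_derivative c) (at 0) \<Longrightarrow> partial_deriv f j \<theta> = c"
  unfolding partial_deriv_def by (rule DERIV_imp_deriv)


section \<open>Responses from an exponential family\<close>

lemma fisher_information_diag:
  "fisher_information N L \<psi> $ j $ j =
    (\<integral>y. (partial_deriv (\<lambda>\<psi>'. ln (L \<psi>' y)) j \<psi>)\<^sup>2 \<partial>density N (\<lambda>y. ennreal (L \<psi> y)))"
  by (simp add: fisher_information_def score_def power2_eq_square)

lemma measurable_ident_base:
  assumes "pdf_or_pmf_base \<nu>" shows "(\<lambda>y. y) \<in> borel_measurable \<nu>"
  using assms by (auto simp: pdf_or_pmf_base_def intro!: measurable_restrict_space1)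

lemma sigma_finite_base:
  assumes "pdf_or_pmf_base \<nu>" shows "sigma_finite_measure \<nu>"
  using assms by (auto simp: pdf_or_pmf_base_def intro!: sigma_finite_measure_restrict_space
      sigma_finite_measure_count_space_countable lborel.sigma_finite_measure_axioms)

lemma measurable_ef_density:
  assumes "exp_family_at F \<gamma>" shows "ef_density F \<gamma>' z \<in> borel_measurable (base F)"
proof -
  have [measurable]: "(\<lambda>y. y) \<in> borel_measurable (base F)"
      "c1_fun F \<in> borel_measurable (base F)" "c2_fun F \<in> borel_measurable (base F)"
    using assms by (auto simp: exp_family_at_def intro: measurable_ident_base)
  show ?thesis unfolding ef_density_def[abs_def] by measurable
qed

lemma exp_family_atD:
  assumes "exp_family_at F \<gamma>" "z \<in> nat_space F"
  shows "\<gamma> > 0" "prob_space (ef_response F \<gamma> z)"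
    "integrable (ef_response F \<gamma> z) (\<lambda>y. y)" "integrable (ef_response F \<gamma> z) (\<lambda>y. y\<^sup>2)"
    "(\<integral>y. y \<partial>ef_response F \<gamma> z) = deriv (b_fun F) z"
    "ef_var F \<gamma> z = \<gamma> * deriv (deriv (b_fun F)) z" "ef_var F \<gamma> z > 0"
    "deriv (deriv (b_fun F)) z > 0"
    "(b_fun F has_real_derivative deriv (b_fun F) z) (at z)"
    "(deriv (b_fun F) has_real_derivative deriv (deriv (b_fun F)) z) (at z)"
proof -
  have pos: "\<gamma> > 0" and reg: "b_fun F differentiable at z \<and> deriv (b_fun F) differentiable at z \<and>
        prob_space (ef_response F \<gamma> z) \<and>
        integrable (ef_response F \<gamma> z) (\<lambda>y. y) \<and>
        integrable (ef_response F \<gamma> z) (\<lambda>y. y\<^sup>2) \<and>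
        prob_space.expectation (ef_response F \<gamma> z) (\<lambda>y. y) = deriv (b_fun F) z \<and>
        ef_var F \<gamma> z = \<gamma> * deriv (deriv (b_fun F)) z \<and>
        ef_var F \<gamma> z > 0"
    using assms unfolding exp_family_at_def by blast+
  have "\<gamma> * deriv (deriv (b_fun F)) z > 0"
    using reg by metis
  thus "deriv (deriv (b_fun F)) z > 0"
    using pos by (simp only: zero_less_mult_iff) linarith
  show "\<gamma> > 0" by (rule pos)
  show "(b_fun F has_real_derivative deriv (b_fun F) z) (at z)"
    "(deriv (b_fun F) has_real_derivative deriv (deriv (b_fun F)) z) (at z)"
    using reg by (simp_all only: DERIV_deriv_iff_real_differentiable)
qed (use assms in \<open>unfold exp_family_at_def, blast+\<close>)

text \<open>The responses are independent under the model, so moments of the score factorise.\<close>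

lemma density_ef_likelihood:
  assumes F: "exp_family_at F \<gamma>" and z: "\<And>i. \<zeta> \<theta> (D $ i) \<in> nat_space F"
  shows "density (ef_base F) (\<lambda>y. ennreal (ef_likelihood F \<zeta> D \<gamma> \<theta> y)) =
    PiM UNIV (\<lambda>i. ef_response F \<gamma> (\<zeta> \<theta> (D $ i)))"
proof -
  have base: "pdf_or_pmf_base (base F)" using F by (simp add: exp_family_at_def)
  have "ennreal (ef_likelihood F \<zeta> D \<gamma> \<theta> y) = (\<Prod>i\<in>UNIV. ennreal (ef_density F \<gamma> (\<zeta> \<theta> (D $ i)) (y i)))" for y
    unfolding ef_likelihood_def by (rule prod_ennreal[symmetric]) (simp add: ef_density_def)
  moreover have "sigma_finite_measure (density (base F) (\<lambda>y. ennreal (ef_density F \<gamma> (\<zeta> \<theta> (D $ i)) y)))" for i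
    using exp_family_atD(2)[OF F z] unfolding ef_response_def
    by (intro finite_measure.axioms prob_space.axioms) 
  ultimately show ?thesis
    unfolding ef_base_def ef_response_def
    using PiM_density[where M = "\<lambda>_. base F" and g = "\<lambda>i x. ennreal (ef_density F \<gamma> (\<zeta> \<theta> (D $ i)) x)"]
      measurable_ef_density[OF F] sigma_finite_base[OF base]
    by simp
qed

lemma ln_ef_likelihood:
  "ln (ef_likelihood F \<zeta> D \<gamma> \<theta> y) = (\<Sum>i\<in>UNIV.
    (y i * \<zeta> \<theta> (D $ i) - b_fun F (\<zeta> \<theta> (D $ i)) - c1_fun F (y i)) / \<gamma>
    - 1 / 2 * a_fun F (- 1 / \<gamma>) + c2_fun F (y i))"
  by (simp add: ef_likelihood_def ef_density_def exp_sum[symmetric])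


section \<open>Information about the mean parameters\<close>

locale mean_model =
  fixes F :: exp_family and \<Theta> :: "(real ^ 'p) set" and \<D> :: "(real ^ 'k) set"
    and \<mu> \<zeta> :: "real ^ 'p \<Rightarrow> real ^ 'k \<Rightarrow> real"
  assumes open_Theta: "open \<Theta>"
    and mean_diff: "\<And>\<theta> d. \<theta> \<in> \<Theta> \<Longrightarrow> d \<in> \<D> \<Longrightarrow> (\<lambda>t. \<mu> t d) differentiable (at \<theta>)"
    and link: "mean_link F \<Theta> \<D> \<mu> \<zeta>"
begin

lemma nat_space_zeta: "\<theta> \<in> \<Theta> \<Longrightarrow> d \<in> \<D> \<Longrightarrow> \<zeta> \<theta> d \<in> nat_space F"
  and deriv_b_zeta: "\<theta> \<in> \<Theta> \<Longrightarrow> d \<in> \<D> \<Longrightarrow> deriv (b_fun F) (\<zeta> \<theta> d) = \<mu> \<theta> d"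
  using link by (auto simp: mean_link_def)

text \<open>Differentiability of \<open>\<zeta>\<close> in the parameters is a consequence of that of \<open>\<mu>\<close>, by
  \<open>b' \<zeta> = \<mu>\<close> on the open set \<open>\<Theta>\<close>. The factor \<open>\<gamma> / var\<close> is \<open>1 / b'' \<zeta>\<close>.\<close>

lemma zeta_derivative:
  assumes F: "exp_family_at F \<gamma>" and \<theta>: "\<theta> \<in> \<Theta>" and d: "d \<in> \<D>"
  shows "((\<lambda>t. \<zeta> (\<theta> + t *\<^sub>R axis j 1) d) has_real_derivative
    \<gamma> * partial_deriv (\<lambda>t. \<mu> t d) j \<theta> / ef_var F \<gamma> (\<zeta> \<theta> d)) (at 0)"
proof -
  have "((\<lambda>t. \<theta> + t *\<^sub>R axis j 1) \<longlongrightarrow> \<theta> + 0 *\<^sub>R axis j 1) (nhds (0::real))"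
    by (intro tendsto_intros filterlim_ident)
  hence "\<forall>\<^sub>F t in nhds 0. \<theta> + t *\<^sub>R axis j 1 \<in> \<Theta>"
    using open_Theta \<theta> by (intro topological_tendstoD) auto
  hence ev: "\<forall>\<^sub>F t in nhds 0. \<zeta> (\<theta> + t *\<^sub>R axis j 1) d \<in> nat_space F \<and>
      deriv (b_fun F) (\<zeta> (\<theta> + t *\<^sub>R axis j 1) d) = \<mu> (\<theta> + t *\<^sub>R axis j 1) d"
    by eventually_elim (use d in \<open>simp add: nat_space_zeta deriv_b_zeta\<close>)
  have "((\<lambda>t. \<zeta> (\<theta> + t *\<^sub>R axis j 1) d) has_real_derivative
      partial_deriv (\<lambda>t. \<mu> t d) j \<theta> / deriv (deriv (b_fun F)) (\<zeta> (\<theta> + 0 *\<^sub>R axis j 1) d)) (at 0)"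
  proof (rule has_real_derivative_implicit[OF _ _ _ _ ev])
    show "open (nat_space F)" "is_interval (nat_space F)"
      using F unfolding exp_family_at_def by blast+
    show "((\<lambda>t. \<mu> (\<theta> + t *\<^sub>R axis j 1) d) has_real_derivative partial_deriv (\<lambda>t. \<mu> t d) j \<theta>) (at 0)"
      by (rule has_real_derivative_along_axis[OF mean_diff[OF \<theta> d]])
  qed (rule exp_family_atD[OF F]; assumption)+
  thus ?thesis
    using exp_family_atD(1,6)[OF F nat_space_zeta[OF \<theta> d]] by simp
qed

text \<open>By the chain rule the derivative of the summand \<open>(y i * \<zeta> - b \<zeta>) / \<gamma>\<close> is
  \<open>(y i - b' \<zeta>) / \<gamma>\<close> times that of \<open>\<zeta>\<close>; as \<open>b' \<zeta>\<close> is the mean of \<open>y i\<close>, it is centred.\<close>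

lemma theta_score:
  assumes F: "exp_family_at F \<gamma>" and \<theta>: "\<theta> \<in> \<Theta>" and D: "D \<in> designs \<D>"
  shows "partial_deriv (\<lambda>t. ln (ef_likelihood F \<zeta> D \<gamma> t y)) j \<theta> =
    (\<Sum>i\<in>UNIV. (y i - \<mu> \<theta> (D $ i)) *
      (partial_deriv (\<lambda>t. \<mu> t (D $ i)) j \<theta> / ef_var F \<gamma> (\<zeta> \<theta> (D $ i))))"
proof (rule partial_deriv_eq)
  have d: "D $ i \<in> \<D>" for i using D by (simp add: designs_def)
  have "((\<lambda>t. (y i * \<zeta> (\<theta> + t *\<^sub>R axis j 1) (D $ i) - b_fun F (\<zeta> (\<theta> + t *\<^sub>R axis j 1) (D $ i)) - c1_fun F (y i)) / \<gamma>
      - 1 / 2 * a_fun F (- 1 / \<gamma>) + c2_fun F (y i)) has_real_derivative (y i - \<mu> \<theta> (D $ i)) *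
      (partial_deriv (\<lambda>t. \<mu> t (D $ i)) j \<theta> / ef_var F \<gamma> (\<zeta> \<theta> (D $ i)))) (at 0)" for i
  proof -
    have z: "\<zeta> \<theta> (D $ i) \<in> nat_space F" by (rule nat_space_zeta[OF \<theta> d])
    have "(b_fun F has_real_derivative \<mu> \<theta> (D $ i)) (at (\<zeta> (\<theta> + 0 *\<^sub>R axis j 1) (D $ i)))"
      using exp_family_atD(9)[OF F z] deriv_b_zeta[OF \<theta> d] by simp
    note b = DERIV_chain2[OF this zeta_derivative[OF F \<theta> d]]
    show ?thesis
      by (rule DERIV_cong[OF DERIV_add[OF DERIV_diff[OF DERIV_cdivide[OF DERIV_diff[OF
              DERIV_diff[OF DERIV_cmult[OF zeta_derivative[OF F \<theta> d]] b] DERIV_const]] DERIV_const] DERIV_const]])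
        (use exp_family_atD(1)[OF F z] in \<open>simp add: algebra_simps diff_divide_distrib\<close>)
  qed
  thus "((\<lambda>t. ln (ef_likelihood F \<zeta> D \<gamma> (\<theta> + t *\<^sub>R axis j 1) y)) has_real_derivative
    (\<Sum>i\<in>UNIV. (y i - \<mu> \<theta> (D $ i)) *
      (partial_deriv (\<lambda>t. \<mu> t (D $ i)) j \<theta> / ef_var F \<gamma> (\<zeta> \<theta> (D $ i))))) (at 0)"
    unfolding ln_ef_likelihood by (intro DERIV_sum)
qed

text \<open>The summands of the score are independent and centred, so only their variances remain:
  \<open>var i * (\<partial>\<^sub>j \<mu> i / var i)\<^sup>2\<close> is the term of run \<open>i\<close>.\<close>

lemma theta_information:
  assumes F: "exp_family_at F \<gamma>" and \<theta>: "\<theta> \<in> \<Theta>" and D: "D \<in> designs \<D>"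
  shows "(\<integral>y. (partial_deriv (\<lambda>t. ln (ef_likelihood F \<zeta> D \<gamma> t y)) j \<theta>)\<^sup>2
      \<partial>density (ef_base F) (\<lambda>y. ennreal (ef_likelihood F \<zeta> D \<gamma> \<theta> y))) =
    (\<Sum>i\<in>UNIV. info_term F \<mu> \<zeta> \<gamma> (D $ i) j \<theta>)"
proof -
  have d: "D $ i \<in> \<D>" for i using D by (simp add: designs_def)
  have z: "\<zeta> \<theta> (D $ i) \<in> nat_space F" for i by (rule nat_space_zeta[OF \<theta> d])
  define N where "N i = ef_response F \<gamma> (\<zeta> \<theta> (D $ i))" for i
  define v where "v i = ef_var F \<gamma> (\<zeta> \<theta> (D $ i))" for i
  define w where "w i = partial_deriv (\<lambda>t. \<mu> t (D $ i)) j \<theta> / v i" for i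
  define X where "X i x = (x - \<mu> \<theta> (D $ i)) * w i" for i x
  have N: "prob_space (N i)" "integrable (N i) (\<lambda>y. y)" "integrable (N i) (\<lambda>y. y\<^sup>2)"
    "(\<integral>y. y \<partial>N i) = \<mu> \<theta> (D $ i)" "v i > 0" for i
    using exp_family_atD[OF F z[of i]] deriv_b_zeta[OF \<theta> d] by (auto simp: N_def v_def)
  have v: "v i = (\<integral>x. (x - \<mu> \<theta> (D $ i))\<^sup>2 \<partial>N i)" for i
    using N(4)[of i] by (simp add: v_def ef_var_def N_def)
  interpret N: prob_space "N i" for i by (rule N(1))
  have int: "integrable (N i) (X i)" "integrable (N i) (\<lambda>x. (X i x)\<^sup>2)" for i
    using N(2,3)[of i] by (auto simp: X_def[abs_def] power_mult_distrib power2_diff)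
  have E: "(\<integral>x. X i x \<partial>N i) = 0" for i
    using N(2,4)[of i] by (simp add: X_def N.prob_space)
  have E2: "(\<integral>x. (X i x)\<^sup>2 \<partial>N i) = info_term F \<mu> \<zeta> \<gamma> (D $ i) j \<theta>" for i
    using N(5)[of i] by (simp add: X_def power_mult_distrib v[symmetric])
      (simp add: w_def info_term_def v_def power2_eq_square)
  have "(\<integral>y. (\<Sum>i\<in>UNIV. X i (y i))\<^sup>2 \<partial>PiM UNIV N) = (\<Sum>i\<in>UNIV. info_term F \<mu> \<zeta> \<gamma> (D $ i) j \<theta>)"
    by (simp add: integral_square_sum_PiM[OF N(1) int] E E2 if_distrib cong: if_cong)
  thus ?thesis
    by (simp add: density_ef_likelihood[where \<zeta> = \<zeta>, OF F z] theta_score[OF F \<theta> D] X_def N_def[abs_def] w_def v_def)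
qed

lemma trace_information_A:
  assumes F: "exp_family_at F \<gamma>" and \<theta>: "\<theta> \<in> \<Theta>" and D: "D \<in> designs \<D>"
  shows "trace (fisher_information (ef_base F) (ef_likelihood F \<zeta> D \<gamma>) \<theta>) =
    (\<Sum>i\<in>UNIV. \<Sum>j\<in>UNIV. info_term F \<mu> \<zeta> \<gamma> (D $ i) j \<theta>)"
  unfolding trace_def fisher_information_diag theta_information[OF F \<theta> D] by (rule sum.swap)

end


section \<open>Information about the scale\<close>

text \<open>Let \<open>T = y * z - b z - c\<^sub>1 y\<close> and \<open>u = 1 / \<gamma>\<close>. Multiplying the density at scale \<open>1 / u\<close> by
  \<open>exp (h * T)\<close> gives, up to a factor, the density at scale \<open>1 / (u + h)\<close>, whose total mass is one.
  The moment generating function of \<open>T\<close> at \<open>h\<close> is therefore that factor,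
  \<open>exp ((a (- (u + h)) - a (- u)) / 2)\<close>, which is free of \<open>z\<close>.\<close>

lemma scale_statistic_moments:
  assumes F: "\<forall>\<gamma>>0. exp_family_at F \<gamma>" and "\<gamma> > 0"
  shows "\<exists>m1 m2. \<forall>z\<in>nat_space F.
    integrable (ef_response F \<gamma> z) (\<lambda>y. y * z - b_fun F z - c1_fun F y) \<and>
    integrable (ef_response F \<gamma> z) (\<lambda>y. (y * z - b_fun F z - c1_fun F y)\<^sup>2) \<and>
    (\<integral>y. y * z - b_fun F z - c1_fun F y \<partial>ef_response F \<gamma> z) = m1 \<and>
    (\<integral>y. (y * z - b_fun F z - c1_fun F y)\<^sup>2 \<partial>ef_response F \<gamma> z) = m2"
proof -
  define u where "u = 1 / \<gamma>"
  have u: "u > 0" using \<open>\<gamma> > 0\<close> by (simp add: u_def)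
  define G where "G h = exp ((a_fun F (- (u + h)) - a_fun F (- u)) / 2)" for h
  define s where "s n = u / (8 * real (Suc n))" for n
  have s: "s n > 0" for n
    unfolding s_def using u by simp
  have s_le: "s n \<le> u / 8" for n
    unfolding s_def by (rule divide_left_mono) (use u in auto)
  have "(\<lambda>n. u / 8 * inverse (real (Suc n))) \<longlonglongrightarrow> u / 8 * 0"
    by (intro tendsto_intros LIMSEQ_inverse_real_of_nat)
  hence s0: "s \<longlonglongrightarrow> 0"
    unfolding s_def[abs_def] by (simp add: field_simps)
  define T where "T z y = y * z - b_fun F z - c1_fun F y" for z y
  have main: "integrable (ef_response F \<gamma> z) (T z) \<and> integrable (ef_response F \<gamma> z) (\<lambda>y. (T z y)\<^sup>2) \<and>
      (\<lambda>n. (G (s n) - G 0) / s n) \<longlonglongrightarrow> (\<integral>y. T z y \<partial>ef_response F \<gamma> z) \<and>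
      (\<lambda>n. (G (s n) - 2 * G 0 + G (- s n)) / (s n)\<^sup>2) \<longlonglongrightarrow> (\<integral>y. (T z y)\<^sup>2 \<partial>ef_response F \<gamma> z)"
    if z: "z \<in> nat_space F" for z
  proof -
    have [measurable]: "(\<lambda>y. y) \<in> borel_measurable (base F)" "c1_fun F \<in> borel_measurable (base F)"
      using F[rule_format, OF \<open>\<gamma> > 0\<close>] unfolding exp_family_at_def by (blast intro: measurable_ident_base)+
    have dens: "ef_density F \<gamma>' z \<in> borel_measurable (base F)" for \<gamma>'
      by (rule measurable_ef_density[OF F[rule_format, OF \<open>\<gamma> > 0\<close>]])
    have T: "T z \<in> borel_measurable (ef_response F \<gamma> z)"
      unfolding ef_response_def T_def[abs_def] by measurable
    have mgf: "integrable (ef_response F \<gamma> z) (\<lambda>y. exp (h * T z y)) \<and>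
        (\<integral>y. exp (h * T z y) \<partial>ef_response F \<gamma> z) = G h" if h: "\<bar>h\<bar> < u" for h
    proof -
      define \<gamma>' where "\<gamma>' = 1 / (u + h)"
      have pos: "u + h > 0" using h by linarith
      hence \<gamma>': "\<gamma>' > 0" by (simp add: \<gamma>'_def)
      interpret R: prob_space "ef_response F \<gamma>' z"
        by (rule exp_family_atD(2)[OF F[rule_format, OF \<gamma>'] z])
      have nn: "AE y in base F. 0 \<le> ef_density F \<gamma>'' z y" for \<gamma>''
        by (simp add: ef_density_def)
      have "integrable (ef_response F \<gamma>' z) (\<lambda>_. 1 :: real)" "(\<integral>y. 1 \<partial>ef_response F \<gamma>' z) = (1 :: real)"
        by (simp_all add: R.prob_space)
      hence 1: "integrable (base F) (ef_density F \<gamma>' z)" "(\<integral>y. ef_density F \<gamma>' z y \<partial>base F) = 1"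
        unfolding ef_response_def
        by (simp_all add: integrable_density[OF _ dens nn] integral_density[OF _ dens nn] del: lebesgue_integral_const)
      have tilt: "ef_density F \<gamma> z y * exp (h * T z y) = G h * ef_density F \<gamma>' z y" for y
      proof -
        have eqs: "- 1 / \<gamma> = - u" "- 1 / \<gamma>' = - (u + h)" "T z y / \<gamma> = u * T z y" "T z y / \<gamma>' = (u + h) * T z y"
          by (simp_all add: u_def \<gamma>'_def)
        show ?thesis
          unfolding ef_density_def T_def[symmetric] G_def mult_exp_exp eqs
          by (simp add: algebra_simps diff_divide_distrib)
      qed
      have meas: "(\<lambda>y. exp (h * T z y)) \<in> borel_measurable (base F)"
        unfolding T_def[abs_def] by measurable
      show ?thesis
        unfolding ef_response_def integrable_density[OF meas dens nn] integral_density[OF meas dens nn]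
        using 1 by (simp add: tilt)
    qed
    show ?thesis
      using moments_from_mgf[OF T u _ s s_le s0, of G] mgf by blast
  qed
  define m1 where "m1 = lim (\<lambda>n. (G (s n) - G 0) / s n)"
  define m2 where "m2 = lim (\<lambda>n. (G (s n) - 2 * G 0 + G (- s n)) / (s n)\<^sup>2)"
  have "\<forall>z\<in>nat_space F. integrable (ef_response F \<gamma> z) (T z) \<and> integrable (ef_response F \<gamma> z) (\<lambda>y. (T z y)\<^sup>2) \<and>
      (\<integral>y. T z y \<partial>ef_response F \<gamma> z) = m1 \<and> (\<integral>y. (T z y)\<^sup>2 \<partial>ef_response F \<gamma> z) = m2"
    unfolding m1_def m2_def using main by (blast intro: limI[symmetric])
  thus ?thesis
    unfolding T_def[abs_def] by blast
qed

lemma theta_part_join_par [simp]: "theta_part (join_par \<theta> \<gamma>) = \<theta>"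
  and gamma_part_join_par [simp]: "gamma_part (join_par \<theta> \<gamma>) = \<gamma>"
  by (simp_all add: theta_part_def gamma_part_def join_par_def)

lemma join_par_axis_Some:
  "join_par \<theta> \<gamma> + t *\<^sub>R axis (Some j) 1 = join_par (\<theta> + t *\<^sub>R axis j 1) \<gamma>"
  by (auto simp: vec_eq_iff join_par_def axis_def split: option.split)

lemma join_par_axis_None: "join_par \<theta> \<gamma> + t *\<^sub>R axis None 1 = join_par \<theta> (\<gamma> + t)"
  by (auto simp: vec_eq_iff join_par_def axis_def split: option.split)

lemma joint_score_Some:
  "partial_deriv (\<lambda>\<psi>. ln (joint_likelihood F \<zeta> D \<psi> y)) (Some j) (join_par \<theta> \<gamma>) =
    partial_deriv (\<lambda>t. ln (ef_likelihood F \<zeta> D \<gamma> t y)) j \<theta>"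
  by (simp add: partial_deriv_def joint_likelihood_def join_par_axis_Some)

lemma joint_score_None:
  assumes "\<gamma> > 0" and a: "a_fun F differentiable (at (- 1 / \<gamma>))"
  shows "partial_deriv (\<lambda>\<psi>. ln (joint_likelihood F \<zeta> D \<psi> y)) None (join_par \<theta> \<gamma>) =
    (\<Sum>i\<in>UNIV. - ((y i * \<zeta> \<theta> (D $ i) - b_fun F (\<zeta> \<theta> (D $ i)) - c1_fun F (y i))
      + deriv (a_fun F) (- 1 / \<gamma>) / 2) / \<gamma>\<^sup>2)"
proof (rule partial_deriv_eq)
  have inv: "((\<lambda>t. c / (\<gamma> + t)) has_real_derivative - c / \<gamma>\<^sup>2) (at 0)" for c
    using \<open>\<gamma> > 0\<close> by (auto intro!: derivative_eq_intros simp: power2_eq_square)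
  have "(a_fun F has_real_derivative deriv (a_fun F) (- 1 / \<gamma>)) (at (- 1 / (\<gamma> + 0)))"
    using a by (simp add: DERIV_deriv_iff_real_differentiable)
  note a' = DERIV_chain2[OF this inv]
  have "((\<lambda>t. (y i * \<zeta> \<theta> (D $ i) - b_fun F (\<zeta> \<theta> (D $ i)) - c1_fun F (y i)) / (\<gamma> + t)
      - 1 / 2 * a_fun F (- 1 / (\<gamma> + t)) + c2_fun F (y i)) has_real_derivative
      - ((y i * \<zeta> \<theta> (D $ i) - b_fun F (\<zeta> \<theta> (D $ i)) - c1_fun F (y i))
      + deriv (a_fun F) (- 1 / \<gamma>) / 2) / \<gamma>\<^sup>2) (at 0)" for i
    by (rule DERIV_cong[OF DERIV_add[OF DERIV_diff[OF inv DERIV_cmult[OF a']] DERIV_const]])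
      (simp add: divide_simps)
  thus "((\<lambda>t. ln (joint_likelihood F \<zeta> D (join_par \<theta> \<gamma> + t *\<^sub>R axis None 1) y)) has_real_derivative
    (\<Sum>i\<in>UNIV. - ((y i * \<zeta> \<theta> (D $ i) - b_fun F (\<zeta> \<theta> (D $ i)) - c1_fun F (y i))
      + deriv (a_fun F) (- 1 / \<gamma>) / 2) / \<gamma>\<^sup>2)) (at 0)"
    unfolding joint_likelihood_def join_par_axis_None theta_part_join_par gamma_part_join_par
      ln_ef_likelihood by (intro DERIV_sum)
qed

lemma sum_UNIV_option:
  "(\<Sum>m\<in>(UNIV :: 'a::finite option set). f m) = f None + (\<Sum>j\<in>UNIV. f (Some j))"
  by (simp add: UNIV_option_conv sum.reindex)

context mean_model
begin

text \<open>The score for the scale is a sum of independent terms that are affine in the statistics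
  \<open>T\<close>, with coefficients depending on \<open>\<gamma>\<close> only.\<close>

lemma scale_information:
  assumes F: "\<forall>\<gamma>>0. exp_family_at F \<gamma>" and \<gamma>: "\<gamma> > 0" and \<theta>: "\<theta> \<in> \<Theta>"
  shows "\<exists>K. \<forall>D\<in>(designs \<D> :: (real ^ 'k ^ 'n) set).
    fisher_information (ef_base F) (joint_likelihood F \<zeta> D) (join_par \<theta> \<gamma>) $ None $ None = K"
proof -
  obtain m1 m2 where m: "\<forall>z\<in>nat_space F.
    integrable (ef_response F \<gamma> z) (\<lambda>y. y * z - b_fun F z - c1_fun F y) \<and>
    integrable (ef_response F \<gamma> z) (\<lambda>y. (y * z - b_fun F z - c1_fun F y)\<^sup>2) \<and>
    (\<integral>y. y * z - b_fun F z - c1_fun F y \<partial>ef_response F \<gamma> z) = m1 \<and>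
    (\<integral>y. (y * z - b_fun F z - c1_fun F y)\<^sup>2 \<partial>ef_response F \<gamma> z) = m2"
    using scale_statistic_moments[OF F \<gamma>] by (elim exE)
  define A where "A = deriv (a_fun F) (- 1 / \<gamma>) / 2"
  have a: "a_fun F differentiable (at (- 1 / \<gamma>))"
    using F[rule_format, OF \<gamma>] \<gamma> unfolding exp_family_at_def by simp
  define e1 where "e1 = - (m1 + A) / \<gamma>\<^sup>2"
  define e2 where "e2 = (m2 + 2 * A * m1 + A\<^sup>2) / (\<gamma>\<^sup>2)\<^sup>2"
  have "fisher_information (ef_base F) (joint_likelihood F \<zeta> D) (join_par \<theta> \<gamma>) $ None $ None =
      (\<Sum>i\<in>(UNIV :: 'n set). \<Sum>k\<in>(UNIV :: 'n set). if i = k then e2 else e1 * e1)"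
    if D: "D \<in> designs \<D>" for D :: "real ^ 'k ^ 'n"
  proof -
    have z: "\<zeta> \<theta> (D $ i) \<in> nat_space F" for i
      using D by (intro nat_space_zeta[OF \<theta>]) (simp add: designs_def)
    define N where "N i = ef_response F \<gamma> (\<zeta> \<theta> (D $ i))" for i
    define T where "T i x = x * \<zeta> \<theta> (D $ i) - b_fun F (\<zeta> \<theta> (D $ i)) - c1_fun F x" for i x
    define X where "X i x = - (T i x + A) / \<gamma>\<^sup>2" for i x
    have N: "prob_space (N i)" for i
      unfolding N_def by (rule exp_family_atD(2)[OF F[rule_format, OF \<gamma>] z])
    interpret N: prob_space "N i" for i by (rule N)
    have T: "integrable (N i) (T i)" "integrable (N i) (\<lambda>x. (T i x)\<^sup>2)"
      "(\<integral>x. T i x \<partial>N i) = m1" "(\<integral>x. (T i x)\<^sup>2 \<partial>N i) = m2" for i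
      using bspec[OF m z[of i]] by (simp_all add: T_def[abs_def] N_def)
    have X2: "(X i x)\<^sup>2 = ((T i x)\<^sup>2 + 2 * A * T i x + A\<^sup>2) / (\<gamma>\<^sup>2)\<^sup>2" for i x
    proof -
      have "(- (T i x + A))\<^sup>2 = (T i x)\<^sup>2 + 2 * A * T i x + A\<^sup>2"
        by (simp only: power2_minus power2_sum) (simp add: algebra_simps)
      thus ?thesis by (simp only: X_def power_divide)
    qed
    have int: "integrable (N i) (X i)" "integrable (N i) (\<lambda>x. (X i x)\<^sup>2)" for i
      unfolding X2 unfolding X_def[abs_def] using T[of i] by auto
    have E: "(\<integral>x. X i x \<partial>N i) = e1" "(\<integral>x. (X i x)\<^sup>2 \<partial>N i) = e2" for i
      unfolding X2 unfolding X_def[abs_def] e1_def e2_def using T[of i]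
      by (simp_all add: N.prob_space)
    have "fisher_information (ef_base F) (joint_likelihood F \<zeta> D) (join_par \<theta> \<gamma>) $ None $ None =
        (\<integral>y. (\<Sum>i\<in>UNIV. X i (y i))\<^sup>2 \<partial>PiM UNIV N)"
      unfolding fisher_information_diag joint_score_None[OF \<gamma> a]
      unfolding joint_likelihood_def theta_part_join_par gamma_part_join_par density_ef_likelihood[where \<zeta> = \<zeta>, OF F[rule_format, OF \<gamma>] z]
        X_def T_def A_def N_def[abs_def] ..
    also have "\<dots> = (\<Sum>i\<in>(UNIV :: 'n set). \<Sum>k\<in>(UNIV :: 'n set). if i = k then e2 else e1 * e1)"
      by (simp only: integral_square_sum_PiM[OF N int] E)
    finally show ?thesis .
  qed
  thus ?thesis by blast
qed

lemma trace_information_B: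
  assumes F: "\<forall>\<gamma>>0. exp_family_at F \<gamma>" and \<gamma>: "\<gamma> > 0" and \<theta>: "\<theta> \<in> \<Theta>"
  shows "\<exists>K. \<forall>D\<in>(designs \<D> :: (real ^ 'k ^ 'n) set).
    trace (fisher_information (ef_base F) (joint_likelihood F \<zeta> D) (join_par \<theta> \<gamma>)) =
    K + (\<Sum>i\<in>UNIV. \<Sum>j\<in>UNIV. info_term F \<mu> \<zeta> \<gamma> (D $ i) j \<theta>)"
proof -
  obtain K where K: "\<And>D. D \<in> (designs \<D> :: (real ^ 'k ^ 'n) set) \<Longrightarrow>
      fisher_information (ef_base F) (joint_likelihood F \<zeta> D) (join_par \<theta> \<gamma>) $ None $ None = K"
    using scale_information[OF F \<gamma> \<theta>, where 'n = 'n] by blast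
  have "fisher_information (ef_base F) (joint_likelihood F \<zeta> D) (join_par \<theta> \<gamma>) $ Some j $ Some j =
      (\<Sum>i\<in>UNIV. info_term F \<mu> \<zeta> \<gamma> (D $ i) j \<theta>)" if "D \<in> designs \<D>" for D :: "real ^ 'k ^ 'n" and j
    unfolding fisher_information_diag joint_score_Some
    unfolding joint_likelihood_def theta_part_join_par gamma_part_join_par by (rule theta_information[OF F[rule_format, OF \<gamma>] \<theta> that])
  hence "trace (fisher_information (ef_base F) (joint_likelihood F \<zeta> D) (join_par \<theta> \<gamma>)) =
      K + (\<Sum>i\<in>UNIV. \<Sum>j\<in>UNIV. info_term F \<mu> \<zeta> \<gamma> (D $ i) j \<theta>)"
    if "D \<in> designs \<D>" for D :: "real ^ 'k ^ 'n"
    unfolding trace_def sum_UNIV_option using K[OF that] that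
    by (subst sum.swap) simp
  thus ?thesis by blast
qed

end



section \<open>Normal responses with the variance integrated out\<close>

lemma integral_pos_on:
  fixes f :: "'a \<Rightarrow> real"
  assumes f: "integrable M f" "\<And>x. 0 \<le> f x"
    and A: "A \<in> sets M" "emeasure M A > 0" "\<And>x. x \<in> A \<Longrightarrow> f x > 0"
  shows "(\<integral>x. f x \<partial>M) > 0"
proof -
  have "(\<integral>x. f x \<partial>M) \<noteq> 0"
  proof
    assume "(\<integral>x. f x \<partial>M) = 0"
    hence "AE x in M. f x = 0"
      using f by (simp add: integral_nonneg_eq_0_iff_AE)
    hence "AE x in M. x \<notin> A"
      by eventually_elim (use A(3) in force)
    hence "emeasure M A = 0"
      using A(1) sets.sets_into_space[OF A(1)] by (subst (asm) AE_iff_measurable[of A]) auto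
    thus False using A(2) by simp
  qed
  thus ?thesis
    using f(2) by (simp add: order.strict_iff_order)
qed

lemma integrable_powr_at_top:
  fixes e :: real
  assumes "e < - 1"
  shows "integrable lborel (\<lambda>x. indicator {1..} x * x powr e)"
proof -
  have "(\<lambda>x. x powr e) integrable_on {1..}"
    using has_integral_powr_to_inf[OF assms, of 1] by (auto simp: integrable_on_def)
  hence "(\<lambda>x. x powr e) absolutely_integrable_on {1..}"
    by (rule nonnegative_absolutely_integrable_1) simp
  hence "integrable lebesgue (\<lambda>x. indicator {1..} x * x powr e)"
    by (simp add: set_integrable_def)
  thus ?thesis
    by (subst (asm) integrable_completion) measurable
qed

text \<open>By the substitution \<open>x \<mapsto> 1 / x\<close> this is \<open>Gamma a\<close> for \<open>a > 0\<close>.\<close>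

definition inverse_gamma_integral :: "real \<Rightarrow> real" where
  "inverse_gamma_integral a = (\<integral>x. indicator {0<..} x * (x powr (- a - 1) * exp (- 1 / x)) \<partial>lborel)"

lemma inverse_gamma_integral_pos:
  assumes "a > 0" shows "inverse_gamma_integral a > 0"
  unfolding inverse_gamma_integral_def
proof (rule integral_pos_on[where A = "{0<..<1}"])
  let ?f = "\<lambda>x. indicator {0<..} x * (x powr (- a - 1) * exp (- 1 / x)) :: real"
  define s where "s = a + 1"
  have s: "s > 0" using assms by (simp add: s_def)
  have bound: "x powr (- a - 1) * exp (- 1 / x) \<le> s powr s" if "x > 0" for x
  proof -
    \<comment> \<open>This is \<open>v \<le> exp v\<close> at \<open>v = 1 / (x * s)\<close>, raised to the power \<open>s\<close>.\<close>
    have "1 / (x * s) \<le> exp (1 / (x * s))"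
      using exp_ge_add_one_self[of "1 / (x * s)"] by linarith
    hence "(1 / (x * s)) powr s \<le> exp (1 / (x * s)) powr s"
      using s that by (intro powr_mono2) auto
    also have "\<dots> = exp (1 / x)"
      using s that by (simp add: powr_def)
    finally have "(1 / (x * s)) powr s * (s powr s * exp (- 1 / x)) \<le> exp (1 / x) * (s powr s * exp (- 1 / x))"
      by (intro mult_right_mono) auto
    also have "\<dots> = s powr s"
      by (simp add: exp_minus field_simps)
    also have "(1 / (x * s)) powr s * (s powr s * exp (- 1 / x)) = x powr (- s) * exp (- 1 / x)"
      using s that by (simp add: powr_divide powr_mult powr_minus field_simps)
    finally show ?thesis by (simp add: s_def)
  qed
  show "integrable lborel ?f"
  proof (rule Bochner_Integration.integrable_bound)
    show "integrable lborel (\<lambda>x. indicator {0..1} x * s powr s + indicator {1..} x * x powr (- a - 1))"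
      using integrable_powr_at_top[of "- a - 1"] assms by auto
    show "AE x in lborel. norm (?f x) \<le> norm (indicator {0..1} x * s powr s + indicator {1..} x * x powr (- a - 1))"
    proof (rule AE_I2)
      fix x :: real
      have "\<bar>?f x\<bar> \<le> indicator {0..1} x * s powr s + indicator {1..} x * x powr (- a - 1)"
      proof (cases "x > 1")
        case True
        thus ?thesis by (simp add: abs_mult mult_left_le)
      next
        case False
        thus ?thesis using bound[of x] by (cases "x > 0") (auto simp: abs_mult indicator_def intro: add_increasing2)
      qed
      thus "norm (?f x) \<le> norm (indicator {0..1} x * s powr s + indicator {1..} x * x powr (- a - 1))"
        by simp
    qed
  qed measurable
  show "?f x > 0" if "x \<in> {0<..<1}" for x using that by simp
qed simp_all

lemma inverse_gamma_integral_scale: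
  assumes "\<beta> > 0"
  shows "(\<integral>x. indicator {0<..} x * (x powr (- a - 1) * exp (- \<beta> / x)) \<partial>lborel) =
    \<beta> powr (- a) * inverse_gamma_integral a"
proof -
  have "(\<integral>x. indicator {0<..} x * (x powr (- a - 1) * exp (- \<beta> / x)) \<partial>lborel) =
      \<beta> * (\<integral>x. indicator {0<..} (\<beta> * x) * ((\<beta> * x) powr (- a - 1) * exp (- \<beta> / (\<beta> * x))) \<partial>lborel)"
    using assms by (subst lborel_integral_real_affine[where c = \<beta> and t = 0]) auto
  also have "(\<integral>x. indicator {0<..} (\<beta> * x) * ((\<beta> * x) powr (- a - 1) * exp (- \<beta> / (\<beta> * x))) \<partial>lborel) =
      (\<integral>x. \<beta> powr (- a - 1) * (indicator {0<..} x * (x powr (- a - 1) * exp (- 1 / x))) \<partial>lborel)"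
    using assms by (intro Bochner_Integration.integral_cong)
      (auto simp: indicator_def zero_less_mult_iff powr_mult)
  also have "\<dots> = \<beta> powr (- a - 1) * inverse_gamma_integral a"
    by (simp add: inverse_gamma_integral_def)
  also have "\<beta> * (\<beta> powr (- a - 1) * inverse_gamma_integral a) = \<beta> powr (- a) * inverse_gamma_integral a"
    using assms by (simp add: powr_diff)
  finally show ?thesis .
qed

lemma normal_likelihood_eq:
  fixes D :: "real ^ 'k ^ 'n"
  assumes "\<gamma> > 0"
  shows "normal_likelihood \<mu> D \<gamma> \<theta> y = (2 * pi) powr (- real CARD('n) / 2) * \<gamma> powr (- real CARD('n) / 2) *
    exp (- (\<Sum>i\<in>UNIV. (y i - \<mu> \<theta> (D $ i))\<^sup>2) / (2 * \<gamma>))"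
proof -
  have "1 / sqrt (2 * pi * \<gamma>) = (2 * pi * \<gamma>) powr (- 1 / 2)"
    using assms by (simp add: powr_minus powr_half_sqrt field_simps)
  hence "(1 / sqrt (2 * pi * \<gamma>)) ^ CARD('n) = (2 * pi * \<gamma>) powr (- real CARD('n) / 2)"
    using assms by (simp add: powr_realpow[symmetric] powr_powr)
  also have "\<dots> = (2 * pi) powr (- real CARD('n) / 2) * \<gamma> powr (- real CARD('n) / 2)"
    using assms by (simp add: powr_mult)
  finally have const: "(\<Prod>i\<in>(UNIV :: 'n set). 1 / sqrt (2 * pi * \<gamma>)) = \<dots>"
    by simp
  have "(sqrt \<gamma>)\<^sup>2 = \<gamma>"
    using assms by simp
  thus ?thesis
    unfolding normal_likelihood_def normal_density_def prod.distrib
    by (simp only: const exp_sum[OF finite, symmetric] sum_negf[symmetric] sum_divide_distrib)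
qed

text \<open>Up to constants, the integrand is the kernel of an inverse gamma density with shape
  \<open>(s1 + n) / 2\<close> and scale half of \<open>s2\<close> plus the residual sum of squares. The
  constant \<open>K\<close> is the same for all designs.\<close>

lemma marginal_likelihood_eq:
  fixes \<mu> :: "real ^ 'p \<Rightarrow> real ^ 'k \<Rightarrow> real"
  assumes "s1 > 0" "s2 > 0"
  shows "\<exists>K>0. \<forall>(D :: real ^ 'k ^ 'n) \<theta> y. marginal_likelihood \<mu> s1 s2 D \<theta> y =
    K * (s2 + (\<Sum>i\<in>UNIV. (y i - \<mu> \<theta> (D $ i))\<^sup>2)) powr (- ((s1 + CARD('n)) / 2))"
proof -
  define a where "a = (s1 + CARD('n)) / 2"
  have a: "a > 0" using assms by (simp add: a_def add_pos_nonneg)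
  define C where "C = s2 powr (s1 / 2) / (2 powr (s1 / 2) * Gamma (s1 / 2)) * (2 * pi) powr (- real CARD('n) / 2)"
  have C: "C > 0" using assms by (simp add: C_def Gamma_real_pos)
  have "marginal_likelihood \<mu> s1 s2 D \<theta> y =
      C * 2 powr a * inverse_gamma_integral a * (s2 + (\<Sum>i\<in>UNIV. (y i - \<mu> \<theta> (D $ i))\<^sup>2)) powr (- a)"
    for D :: "real ^ 'k ^ 'n" and \<theta> y
  proof -
    define Q where "Q = (\<Sum>i\<in>UNIV. (y i - \<mu> \<theta> (D $ i))\<^sup>2)"
    have "Q \<ge> 0" unfolding Q_def by (intro sum_nonneg) auto
    hence \<beta>: "(s2 + Q) / 2 > 0" using assms by simp
    have "normal_likelihood \<mu> D \<gamma> \<theta> y * inverse_gamma_density s1 s2 \<gamma> =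
        C * (\<gamma> powr (- a - 1) * exp (- ((s2 + Q) / 2) / \<gamma>))" if "\<gamma> > 0" for \<gamma>
    proof -
      have "- real CARD('n) / 2 + (- s1 / 2 - 1) = - a - 1"
        by (simp add: a_def field_simps)
      hence pw: "\<gamma> powr (- real CARD('n) / 2) * \<gamma> powr (- s1 / 2 - 1) = \<gamma> powr (- a - 1)"
        by (metis powr_add)
      have ex: "exp (- Q / (2 * \<gamma>)) * exp (- s2 / (2 * \<gamma>)) = exp (- ((s2 + Q) / 2) / \<gamma>)"
        using that by (simp add: mult_exp_exp field_simps)
      have "normal_likelihood \<mu> D \<gamma> \<theta> y * inverse_gamma_density s1 s2 \<gamma> =
          C * ((\<gamma> powr (- real CARD('n) / 2) * \<gamma> powr (- s1 / 2 - 1)) *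
            (exp (- Q / (2 * \<gamma>)) * exp (- s2 / (2 * \<gamma>))))"
        unfolding normal_likelihood_eq[OF that] inverse_gamma_density_def C_def Q_def
        by (simp only: mult_ac)
      thus ?thesis
        by (simp only: pw ex)
    qed
    hence "marginal_likelihood \<mu> s1 s2 D \<theta> y =
        (\<integral>\<gamma>. C * (indicator {0<..} \<gamma> * (\<gamma> powr (- a - 1) * exp (- ((s2 + Q) / 2) / \<gamma>))) \<partial>lborel)"
      unfolding marginal_likelihood_def set_lebesgue_integral_def
      by (intro Bochner_Integration.integral_cong) (auto simp: indicator_def)
    also have "\<dots> = C * (((s2 + Q) / 2) powr (- a) * inverse_gamma_integral a)"
      by (simp only: integral_mult_right_zero inverse_gamma_integral_scale[OF \<beta>])
    also have "((s2 + Q) / 2) powr (- a) = 2 powr a * (s2 + Q) powr (- a)"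
      using \<beta> by (simp add: powr_divide powr_minus field_simps)
    finally show ?thesis by (simp add: Q_def)
  qed
  moreover have "C * 2 powr a * inverse_gamma_integral a > 0"
    using C inverse_gamma_integral_pos[OF a] by simp
  ultimately show ?thesis
    unfolding a_def by blast
qed

lemma marginal_score:
  fixes D :: "real ^ 'k ^ 'n"
  assumes "K > 0" "s2 > 0"
    and L: "\<And>\<theta>. L \<theta> = K * (s2 + (\<Sum>i\<in>UNIV. (y i - \<mu> \<theta> (D $ i))\<^sup>2)) powr (- a)"
    and \<mu>: "\<And>i. (\<lambda>t. \<mu> t (D $ i)) differentiable (at \<theta>)"
  shows "partial_deriv (\<lambda>t. ln (L t)) j \<theta> =
    2 * a * (\<Sum>i\<in>UNIV. (y i - \<mu> \<theta> (D $ i)) * partial_deriv (\<lambda>t. \<mu> t (D $ i)) j \<theta>) /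
      (s2 + (\<Sum>i\<in>UNIV. (y i - \<mu> \<theta> (D $ i))\<^sup>2))"
proof (rule partial_deriv_eq)
  define Q where "Q \<theta> = s2 + (\<Sum>i\<in>UNIV. (y i - \<mu> \<theta> (D $ i))\<^sup>2)" for \<theta>
  have Q: "Q \<theta> > 0" for \<theta>
    unfolding Q_def using \<open>s2 > 0\<close> by (intro add_pos_nonneg sum_nonneg) auto
  have lnL: "ln (L \<theta>) = ln K - a * ln (Q \<theta>)" for \<theta>
    unfolding L Q_def[symmetric] using \<open>K > 0\<close> Q[of \<theta>] by (simp add: ln_mult ln_powr)
  have "((\<lambda>t. (y i - \<mu> (\<theta> + t *\<^sub>R axis j 1) (D $ i))\<^sup>2) has_real_derivative
      - 2 * ((y i - \<mu> \<theta> (D $ i)) * partial_deriv (\<lambda>t. \<mu> t (D $ i)) j \<theta>)) (at 0)" for i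
    by (rule DERIV_cong[OF DERIV_power[OF DERIV_diff[OF DERIV_const has_real_derivative_along_axis[OF \<mu>]]]])
      simp
  hence "((\<lambda>t. s2 + (\<Sum>i\<in>UNIV. (y i - \<mu> (\<theta> + t *\<^sub>R axis j 1) (D $ i))\<^sup>2)) has_real_derivative
      0 + (\<Sum>i\<in>UNIV. - 2 * ((y i - \<mu> \<theta> (D $ i)) * partial_deriv (\<lambda>t. \<mu> t (D $ i)) j \<theta>))) (at 0)"
    by (intro DERIV_add DERIV_const DERIV_sum)
  hence Q': "((\<lambda>t. Q (\<theta> + t *\<^sub>R axis j 1)) has_real_derivative
      - 2 * (\<Sum>i\<in>UNIV. (y i - \<mu> \<theta> (D $ i)) * partial_deriv (\<lambda>t. \<mu> t (D $ i)) j \<theta>)) (at 0)"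
    unfolding Q_def sum_distrib_left by simp
  have "(ln has_real_derivative 1 / Q \<theta>) (at (Q (\<theta> + 0 *\<^sub>R axis j 1)))"
    using Q by (auto intro!: derivative_eq_intros)
  note ln' = DERIV_chain2[OF this Q']
  show "((\<lambda>t. ln (L (\<theta> + t *\<^sub>R axis j 1))) has_real_derivative
    2 * a * (\<Sum>i\<in>UNIV. (y i - \<mu> \<theta> (D $ i)) * partial_deriv (\<lambda>t. \<mu> t (D $ i)) j \<theta>) /
      (s2 + (\<Sum>i\<in>UNIV. (y i - \<mu> \<theta> (D $ i))\<^sup>2))) (at 0)"
    unfolding lnL Q_def[of \<theta>, symmetric]
    by (rule DERIV_cong[OF DERIV_diff[OF DERIV_const DERIV_cmult[OF ln']]]) simp
qed

lemma distr_PiM_componentwise: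
  fixes M :: "'i::finite \<Rightarrow> 'a measure"
  assumes sf: "\<And>i. sigma_finite_measure (M i)"
    and T: "\<And>i. T i \<in> measurable (M i) (M i)" "\<And>i. distr (M i) (M i) (T i) = M i"
  shows "distr (PiM UNIV M) (PiM UNIV M) (\<lambda>y i. T i (y i)) = PiM UNIV M"
proof -
  interpret product_sigma_finite M
    by unfold_locales (use sf in \<open>auto simp: sigma_finite_measure_def\<close>)
  note T(1)[measurable]
  have [measurable]: "(\<lambda>y i. T i (y i)) \<in> measurable (PiM UNIV M) (PiM UNIV M)"
    by (rule measurable_PiM_single') (auto simp: space_PiM PiE_iff intro: measurable_space[OF T(1)])
  show ?thesis
  proof (rule PiM_eqI)
    fix A assume "\<And>i. i \<in> UNIV \<Longrightarrow> A i \<in> sets (M i)"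
    hence A: "A i \<in> sets (M i)" for i by auto
    hence sets: "Pi\<^sub>E UNIV A \<in> sets (PiM UNIV M)"
      by (intro sets_PiM_I_finite) auto
    have A': "T i -` A i \<inter> space (M i) \<in> sets (M i)" for i
      by (rule measurable_sets[OF T(1) A])
    have "emeasure (distr (PiM UNIV M) (PiM UNIV M) (\<lambda>y i. T i (y i))) (Pi\<^sub>E UNIV A) =
        emeasure (PiM UNIV M) ((\<lambda>y i. T i (y i)) -` Pi\<^sub>E UNIV A \<inter> space (PiM UNIV M))"
      by (rule emeasure_distr) (use sets in auto)
    also have "(\<lambda>y i. T i (y i)) -` Pi\<^sub>E UNIV A \<inter> space (PiM UNIV M) = Pi\<^sub>E UNIV (\<lambda>i. T i -` A i \<inter> space (M i))"
      by (auto simp: space_PiM PiE_iff)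
    also have "emeasure (PiM UNIV M) \<dots> = (\<Prod>i\<in>UNIV. emeasure (M i) (T i -` A i \<inter> space (M i)))"
      by (rule emeasure_PiM) (use A' in auto)
    also have "\<dots> = (\<Prod>i\<in>UNIV. emeasure (distr (M i) (M i) (T i)) (A i))"
      using A by (simp add: emeasure_distr T(1))
    finally show "emeasure (distr (PiM UNIV M) (PiM UNIV M) (\<lambda>y i. T i (y i))) (Pi\<^sub>E UNIV A) =
        (\<Prod>i\<in>UNIV. emeasure (M i) (A i))"
      by (simp add: T(2))
  qed auto
qed

text \<open>Translation turns responses into residuals, which removes the mean from the integrals.\<close>

lemma integral_normal_base_translate:
  fixes f :: "('n::finite \<Rightarrow> real) \<Rightarrow> real"
  assumes f: "f \<in> borel_measurable normal_base"
  shows "(\<integral>y. f (\<lambda>i. m i + y i) \<partial>normal_base) = (\<integral>y. f y \<partial>normal_base)"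
proof -
  have "distr normal_base normal_base (\<lambda>y i. m i + y i) = (normal_base :: ('n \<Rightarrow> real) measure)"
    unfolding normal_base_def
    by (rule distr_PiM_componentwise)
      (use lborel_distr_plus in \<open>auto simp: lborel.sigma_finite_measure_axioms cong: distr_cong\<close>)
  hence "(\<integral>y. f y \<partial>normal_base) = (\<integral>y. f y \<partial>distr normal_base normal_base (\<lambda>y i. m i + y i))"
    by simp
  also have "\<dots> = (\<integral>y. f (\<lambda>i. m i + y i) \<partial>normal_base)"
    by (rule integral_distr[OF _ f])
      (auto simp: normal_base_def intro!: measurable_PiM_single')
  finally show ?thesis ..
qed

text \<open>Reflecting one coordinate shows that integrands odd in it have integral zero.\<close>

lemma integral_normal_base_reflect:
  fixes f :: "('n::finite \<Rightarrow> real) \<Rightarrow> real"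
  assumes f: "f \<in> borel_measurable normal_base"
  shows "(\<integral>y. f (\<lambda>l. if l = i then - y l else y l) \<partial>normal_base) = (\<integral>y. f y \<partial>normal_base)"
proof -
  have "distr normal_base normal_base (\<lambda>y l. (if l = i then uminus else id) (y l)) = (normal_base :: ('n \<Rightarrow> real) measure)"
    unfolding normal_base_def
    by (rule distr_PiM_componentwise)
      (use lborel_distr_uminus in \<open>auto simp: lborel.sigma_finite_measure_axioms distr_id distr_id2 cong: distr_cong\<close>)
  hence "(\<integral>y. f y \<partial>normal_base) = (\<integral>y. f y \<partial>distr normal_base normal_base (\<lambda>y l. (if l = i then uminus else id) (y l)))"
    by simp
  also have "\<dots> = (\<integral>y. f (\<lambda>l. (if l = i then uminus else id) (y l)) \<partial>normal_base)"
    by (rule integral_distr[OF _ f])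
      (auto simp: normal_base_def intro!: measurable_PiM_single')
  finally show ?thesis
    by (simp add: if_distribR cong: if_cong)
qed

lemma integrable_quadratic_powr:
  fixes s b :: real
  assumes "s > 0" "b > 1 / 2"
  shows "integrable lborel (\<lambda>x. (s + x\<^sup>2) powr (- b))"
proof (rule Bochner_Integration.integrable_bound)
  let ?tail = "\<lambda>x. indicator {1..} x * x powr (- 2 * b) :: real"
  let ?g = "\<lambda>x. indicator {-1..1} x * s powr (- b) + ?tail x + ?tail (- x)"
  have tail: "integrable lborel ?tail"
    using integrable_powr_at_top[of "- 2 * b"] assms by simp
  moreover have "integrable lborel (\<lambda>x. ?tail (- x))"
    using lborel_integrable_real_affine[OF tail, of "-1" 0] by simp
  ultimately show "integrable lborel ?g"
    by (intro Bochner_Integration.integrable_add) auto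
  have tail_bound: "(s + x\<^sup>2) powr (- b) \<le> ?tail x" if "x \<ge> 1" for x
  proof -
    have "(s + x\<^sup>2) powr (- b) \<le> (x\<^sup>2) powr (- b)"
      using that assms by (intro powr_mono2') auto
    also have "\<dots> = x powr (- 2 * b)"
      using that by (simp add: powr_powr powr_realpow[symmetric] del: powr_numeral)
    finally show ?thesis using that by simp
  qed
  have mid: "(s + x\<^sup>2) powr (- b) \<le> s powr (- b)" for x
    using assms by (intro powr_mono2') auto
  show "AE x in lborel. norm ((s + x\<^sup>2) powr (- b)) \<le> norm (?g x)"
  proof (rule AE_I2)
    fix x :: real
    have nn: "?tail x \<ge> 0" "?tail (- x) \<ge> 0" "indicator {-1..1} x * s powr (- b) \<ge> 0"
      by simp_all
    consider "x \<ge> 1" | "- x \<ge> 1" | "x \<in> {-1..1}" by fastforce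
    hence "(s + x\<^sup>2) powr (- b) \<le> ?g x"
    proof cases
      case 1 thus ?thesis using tail_bound[of x] nn by linarith
    next
      case 2
      show ?thesis using tail_bound[OF 2] nn unfolding power2_minus by linarith
    next
      case 3
      hence "indicator {-1..1} x * s powr (- b) = s powr (- b)" by simp
      thus ?thesis using mid[of x] nn by linarith
    qed
    thus "norm ((s + x\<^sup>2) powr (- b)) \<le> norm (?g x)"
      by simp
  qed
qed measurable

text \<open>The sum \<open>s2 + |r|\<^sup>2\<close> is at least \<open>s2 + (r i)\<^sup>2\<close> for each \<open>i\<close>. Distributing the exponent evenly
  over the \<open>n\<close> coordinates bounds the kernel by a product of functions of one variable, each with
  exponent \<open>a / n > 1 / 2\<close> and hence integrable.\<close>

lemma integrable_student_kernel:
  assumes "s2 > 0" "a > CARD('n::finite) / 2"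
  shows "integrable normal_base (\<lambda>r :: 'n \<Rightarrow> real. (s2 + (\<Sum>i\<in>UNIV. (r i)\<^sup>2)) powr (- a))"
proof -
  interpret product_sigma_finite "\<lambda>_ :: 'n. lborel :: real measure" by unfold_locales
  define b where "b = a / CARD('n)"
  have b: "b > 1 / 2" using assms by (simp add: b_def field_simps)
  have prod: "integrable normal_base (\<lambda>r :: 'n \<Rightarrow> real. \<Prod>i\<in>UNIV. (s2 + (r i)\<^sup>2) powr (- b))"
    unfolding normal_base_def
    by (intro product_integrable_prod integrable_quadratic_powr) (use assms b in auto)
  show ?thesis
  proof (rule Bochner_Integration.integrable_bound[OF prod])
    show "(\<lambda>r :: 'n \<Rightarrow> real. (s2 + (\<Sum>i\<in>UNIV. (r i)\<^sup>2)) powr (- a)) \<in> borel_measurable normal_base"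
      unfolding normal_base_def by measurable
    show "AE r in normal_base. norm ((s2 + (\<Sum>i\<in>(UNIV :: 'n set). (r i)\<^sup>2)) powr (- a)) \<le>
        norm (\<Prod>i\<in>UNIV. (s2 + (r i)\<^sup>2) powr (- b))"
    proof (rule AE_I2)
      fix r :: "'n \<Rightarrow> real"
      define S where "S = s2 + (\<Sum>i\<in>UNIV. (r i)\<^sup>2)"
      have le: "s2 + (r i)\<^sup>2 \<le> S" for i
        unfolding S_def by (intro add_left_mono member_le_sum) auto
      have "S > 0" unfolding S_def using assms by (intro add_pos_nonneg sum_nonneg) auto
      hence "S powr (- a) = (\<Prod>i\<in>(UNIV :: 'n set). S powr (- b))"
        by (simp add: powr_realpow[symmetric] powr_powr b_def)
      also have "\<dots> \<le> (\<Prod>i\<in>UNIV. (s2 + (r i)\<^sup>2) powr (- b))"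
        using le b assms by (intro prod_mono conjI powr_mono2') (auto intro: add_pos_nonneg)
      finally show "norm ((s2 + (\<Sum>i\<in>UNIV. (r i)\<^sup>2)) powr (- a)) \<le> norm (\<Prod>i\<in>UNIV. (s2 + (r i)\<^sup>2) powr (- b))"
        by (simp add: S_def prod_nonneg)
    qed
  qed
qed

text \<open>The integrand of the information, apart from the residuals: the likelihood kernel over the
  square of the denominator of the score.\<close>

definition student_weight :: "real \<Rightarrow> real \<Rightarrow> ('n::finite \<Rightarrow> real) \<Rightarrow> real" where
  "student_weight s2 a r = (s2 + (\<Sum>i\<in>UNIV. (r i)\<^sup>2)) powr (- a) / (s2 + (\<Sum>i\<in>UNIV. (r i)\<^sup>2))\<^sup>2"

lemma measurable_student_weight [measurable]:
  "student_weight s2 a \<in> borel_measurable normal_base"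
  unfolding student_weight_def[abs_def] normal_base_def by measurable

lemma measurable_normal_base_component [measurable]:
  "(\<lambda>r. r i) \<in> borel_measurable normal_base"
  unfolding normal_base_def by measurable

text \<open>As \<open>\<bar>r i * r k\<bar> \<le> s2 + |r|\<^sup>2\<close>, the integrand is at most \<open>1 / s2\<close> times the kernel. For \<open>i \<noteq> k\<close>
  it is odd in \<open>r i\<close>.\<close>

lemma student_product_moments:
  assumes s2: "s2 > 0" and a: "a > CARD('n::finite) / 2"
  shows "integrable normal_base (\<lambda>r :: 'n \<Rightarrow> real. r i * r k * student_weight s2 a r)"
    and "i \<noteq> k \<Longrightarrow> (\<integral>r. r i * r k * student_weight s2 a r \<partial>(normal_base :: ('n \<Rightarrow> real) measure)) = 0"
    and "(\<integral>r. r i * r i * student_weight s2 a r \<partial>(normal_base :: ('n \<Rightarrow> real) measure)) > 0"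
proof -
  let ?S = "\<lambda>r :: 'n \<Rightarrow> real. s2 + (\<Sum>i\<in>UNIV. (r i)\<^sup>2)"
  have S: "?S r > 0" for r
    using s2 by (intro add_pos_nonneg sum_nonneg) auto
  have weight: "student_weight s2 a r > 0" for r :: "'n \<Rightarrow> real"
    unfolding student_weight_def using S[of r] by simp
  have quot: "x / S\<^sup>2 \<le> 1 / s2" if "x * s2 \<le> S * S" "S > 0" for x S
    using that s2 by (simp add: field_simps power2_eq_square)
  show int: "integrable normal_base (\<lambda>r :: 'n \<Rightarrow> real. r i * r k * student_weight s2 a r)" for i k
  proof (rule Bochner_Integration.integrable_bound)
    show "integrable normal_base (\<lambda>r. ?S r powr (- a) / s2)"
      using integrable_student_kernel[OF assms] by simp
    show "AE r in normal_base. norm (r i * r k * student_weight s2 a r) \<le> norm (?S r powr (- a) / s2)"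
    proof (rule AE_I2)
      fix r :: "'n \<Rightarrow> real"
      have sq: "(r l)\<^sup>2 \<le> (\<Sum>i\<in>UNIV. (r i)\<^sup>2)" for l
        by (rule member_le_sum) auto
      have "2 * \<bar>r i * r k\<bar> \<le> (r i)\<^sup>2 + (r k)\<^sup>2"
        using sum_squares_bound[of "\<bar>r i\<bar>" "\<bar>r k\<bar>"] by (simp add: abs_mult)
      hence "\<bar>r i * r k\<bar> \<le> ?S r"
        using sq[of i] sq[of k] s2 by linarith
      hence "\<bar>r i * r k\<bar> * s2 \<le> ?S r * ?S r"
        using s2 S[of r] by (intro mult_mono) (auto simp: sum_nonneg)
      hence "\<bar>r i * r k\<bar> / (?S r)\<^sup>2 \<le> 1 / s2"
        using S[of r] by (rule quot)
      hence "?S r powr (- a) * (\<bar>r i * r k\<bar> / (?S r)\<^sup>2) \<le> ?S r powr (- a) * (1 / s2)"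
        by (rule mult_left_mono) simp
      moreover have "norm (r i * r k * student_weight s2 a r) = ?S r powr (- a) * (\<bar>r i * r k\<bar> / (?S r)\<^sup>2)"
        unfolding student_weight_def by (simp add: abs_mult)
      ultimately show "norm (r i * r k * student_weight s2 a r) \<le> norm (?S r powr (- a) / s2)"
        using s2 by simp
    qed
  qed measurable
  show "(\<integral>r. r i * r k * student_weight s2 a r \<partial>(normal_base :: ('n \<Rightarrow> real) measure)) = 0" if "i \<noteq> k"
  proof -
    have "student_weight s2 a (\<lambda>l. if l = i then - r l else r l) = student_weight s2 a r" for r :: "'n \<Rightarrow> real"
    proof -
      have "(\<Sum>l\<in>UNIV. (if l = i then - r l else r l)\<^sup>2) = (\<Sum>l\<in>UNIV. (r l)\<^sup>2)"
        by (rule sum.cong) auto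
      thus ?thesis by (simp only: student_weight_def)
    qed
    hence "(\<integral>r. - (r i * r k * student_weight s2 a r) \<partial>(normal_base :: ('n \<Rightarrow> real) measure)) =
        (\<integral>r. r i * r k * student_weight s2 a r \<partial>normal_base)"
      using integral_normal_base_reflect[of "\<lambda>r. r i * r k * student_weight s2 a r" i] that
      by simp
    thus ?thesis by simp
  qed
  show "(\<integral>r. r i * r i * student_weight s2 a r \<partial>(normal_base :: ('n \<Rightarrow> real) measure)) > 0"
    \<comment> \<open>Any box of positive measure that avoids \<open>r i = 0\<close> will do.\<close>
  proof (rule integral_pos_on[where A = "Pi\<^sub>E UNIV (\<lambda>_. {1..2})"])
    interpret product_sigma_finite "\<lambda>_ :: 'n. lborel :: real measure" by unfold_locales
    show "Pi\<^sub>E UNIV (\<lambda>_. {1..2}) \<in> sets (normal_base :: ('n \<Rightarrow> real) measure)"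
      unfolding normal_base_def by (rule sets_PiM_I_finite) auto
    show "emeasure (normal_base :: ('n \<Rightarrow> real) measure) (Pi\<^sub>E UNIV (\<lambda>_. {1..2})) > 0"
      unfolding normal_base_def by (subst emeasure_PiM) auto
    show "0 \<le> r i * r i * student_weight s2 a r" for r :: "'n \<Rightarrow> real"
      using weight[of r] by simp
    show "0 < r i * r i * student_weight s2 a r" if "r \<in> Pi\<^sub>E UNIV (\<lambda>_. {1..2})" for r :: "'n \<Rightarrow> real"
    proof -
      have "r i \<in> {1..2}" using that by (auto simp: PiE_iff)
      thus ?thesis using weight[of r] by simp
    qed
  qed (rule int)
qed

text \<open>The second moment of the score is a quadratic form in the derivatives of \<open>\<mu>\<close> whose matrix is
  diagonal and positive.\<close>

lemma trace_information_C:
  fixes \<mu> :: "real ^ 'p \<Rightarrow> real ^ 'k \<Rightarrow> real"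
  assumes s: "s1 > 0" "s2 > 0"
  shows "\<exists>\<kappa>. (\<forall>i. \<kappa> i > 0) \<and> (\<forall>(D :: real ^ 'k ^ 'n) \<theta>.
    (\<forall>i. (\<lambda>t. \<mu> t (D $ i)) differentiable (at \<theta>)) \<longrightarrow>
    trace (fisher_information normal_base (marginal_likelihood \<mu> s1 s2 D) \<theta>) =
      (\<Sum>i\<in>UNIV. \<kappa> i * (\<Sum>j\<in>UNIV. (partial_deriv (\<lambda>t. \<mu> t (D $ i)) j \<theta>)\<^sup>2)))"
proof -
  define a where "a = (s1 + CARD('n)) / 2"
  have a: "a > 0" "a > CARD('n) / 2" using s by (auto simp: a_def add_pos_nonneg)
  obtain K where "K > 0" and L: "\<And>(D :: real ^ 'k ^ 'n) \<theta> y. marginal_likelihood \<mu> s1 s2 D \<theta> y =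
      K * (s2 + (\<Sum>i\<in>UNIV. (y i - \<mu> \<theta> (D $ i))\<^sup>2)) powr (- a)"
    unfolding a_def using marginal_likelihood_eq[OF s, of \<mu>, where 'n = 'n] by blast
  note moments = student_product_moments[OF s(2) a(2)]
  define C where "C = K * (2 * a)\<^sup>2"
  have "C > 0" using \<open>K > 0\<close> a by (simp add: C_def)
  define \<kappa> where "\<kappa> i = C * (\<integral>r. r i * r i * student_weight s2 a r \<partial>(normal_base :: ('n \<Rightarrow> real) measure))" for i
  have "trace (fisher_information normal_base (marginal_likelihood \<mu> s1 s2 D) \<theta>) =
      (\<Sum>i\<in>UNIV. \<kappa> i * (\<Sum>j\<in>UNIV. (partial_deriv (\<lambda>t. \<mu> t (D $ i)) j \<theta>)\<^sup>2))"
    if \<mu>: "\<forall>i. (\<lambda>t. \<mu> t (D $ i)) differentiable (at \<theta>)" for D :: "real ^ 'k ^ 'n" and \<theta>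
  proof -
    have diag: "fisher_information normal_base (marginal_likelihood \<mu> s1 s2 D) \<theta> $ j $ j =
        (\<Sum>i\<in>UNIV. \<kappa> i * (partial_deriv (\<lambda>t. \<mu> t (D $ i)) j \<theta>)\<^sup>2)" for j
    proof -
      define w where "w i = partial_deriv (\<lambda>t. \<mu> t (D $ i)) j \<theta>" for i
      define m where "m i = \<mu> \<theta> (D $ i)" for i
      define g where "g r = C * ((\<Sum>i\<in>UNIV. r i * w i)\<^sup>2 * student_weight s2 a r)" for r :: "'n \<Rightarrow> real"
      have score: "partial_deriv (\<lambda>t. ln (marginal_likelihood \<mu> s1 s2 D t y)) j \<theta> =
          2 * a * (\<Sum>i\<in>UNIV. (y i - m i) * w i) / (s2 + (\<Sum>i\<in>UNIV. (y i - m i)\<^sup>2))" for y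
        unfolding m_def w_def by (rule marginal_score[OF \<open>K > 0\<close> s(2) L]) (use \<mu> in blast)
      have [measurable]: "marginal_likelihood \<mu> s1 s2 D \<theta> \<in> borel_measurable normal_base"
        unfolding L[abs_def] by measurable
      have gm [measurable]: "g \<in> borel_measurable normal_base"
        unfolding g_def[abs_def] by measurable
      have "fisher_information normal_base (marginal_likelihood \<mu> s1 s2 D) \<theta> $ j $ j =
          (\<integral>y. marginal_likelihood \<mu> s1 s2 D \<theta> y *\<^sub>R
            (2 * a * (\<Sum>i\<in>UNIV. (y i - m i) * w i) / (s2 + (\<Sum>i\<in>UNIV. (y i - m i)\<^sup>2)))\<^sup>2 \<partial>normal_base)"
        unfolding fisher_information_diag score
        by (rule integral_density) (use \<open>K > 0\<close> in \<open>auto simp: L\<close>)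
      also have "\<dots> = (\<integral>y. g (\<lambda>i. - m i + y i) \<partial>normal_base)"
        by (simp add: L g_def m_def[symmetric] student_weight_def C_def power_divide power_mult_distrib mult_ac)
      also have "\<dots> = (\<integral>r. g r \<partial>normal_base)"
        by (rule integral_normal_base_translate[OF gm])
      also have "\<dots> = (\<integral>r. (\<Sum>i\<in>UNIV. \<Sum>k\<in>UNIV. C * w i * w k * (r i * r k * student_weight s2 a r)) \<partial>normal_base)"
        by (simp add: g_def power2_eq_square sum_product sum_distrib_left sum_distrib_right mult_ac)
      also have "\<dots> = (\<Sum>i\<in>UNIV. \<Sum>k\<in>UNIV. C * w i * w k *
          (\<integral>r. r i * r k * student_weight s2 a r \<partial>normal_base))"
        using moments(1) by (simp add: Bochner_Integration.integral_sum)
      also have "\<dots> = (\<Sum>i\<in>UNIV. \<Sum>k\<in>UNIV. if k = i then \<kappa> i * (w i)\<^sup>2 else 0)"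
        by (intro sum.cong refl) (auto simp: moments(2) \<kappa>_def power2_eq_square)
      also have "\<dots> = (\<Sum>i\<in>UNIV. \<kappa> i * (w i)\<^sup>2)"
        by simp
      finally show ?thesis by (simp only: w_def)
    qed
    show ?thesis
      unfolding trace_def diag sum_distrib_left by (rule sum.swap)
  qed
  moreover have "\<kappa> i > 0" for i
    unfolding \<kappa>_def using \<open>C > 0\<close> moments(3) by simp
  ultimately show ?thesis by blast
qed


section \<open>Expected information gain\<close>

text \<open>Working with the difference of two designs avoids splitting off the entry for the scale
  parameter, whose integrability over the prior would have to be established separately.\<close>

lemma expected_gain:
  fixes f :: "'d \<Rightarrow> 'j::finite \<Rightarrow> 'a \<Rightarrow> real" and D D' :: "'d ^ 'n"
  assumes J: "integrable P J" "integrable P J'"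
    and f: "\<And>i j. integrable P (f (D $ i) j)" "\<And>i j. integrable P (f (D' $ i) j)"
    and eq: "AE x in P. J' x - J x =
      (\<Sum>i\<in>UNIV. c i * ((\<Sum>j\<in>UNIV. f (D' $ i) j x) - (\<Sum>j\<in>UNIV. f (D $ i) j x)))"
  shows "(\<integral>x. J' x \<partial>P) - (\<integral>x. J x \<partial>P) =
    (\<Sum>i\<in>UNIV. c i * ((\<Sum>j\<in>UNIV. \<integral>x. f (D' $ i) j x \<partial>P) - (\<Sum>j\<in>UNIV. \<integral>x. f (D $ i) j x \<partial>P)))"
proof -
  have "(\<integral>x. J' x \<partial>P) - (\<integral>x. J x \<partial>P) = (\<integral>x. J' x - J x \<partial>P)"
    using J by simp
  also have "\<dots> = (\<integral>x. (\<Sum>i\<in>UNIV. c i * ((\<Sum>j\<in>UNIV. f (D' $ i) j x) - (\<Sum>j\<in>UNIV. f (D $ i) j x))) \<partial>P)"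
    using J f eq by (intro integral_cong_AE) auto
  also have "\<dots> = (\<Sum>i\<in>UNIV. c i * ((\<Sum>j\<in>UNIV. \<integral>x. f (D' $ i) j x \<partial>P) - (\<Sum>j\<in>UNIV. \<integral>x. f (D $ i) j x \<partial>P)))"
    using f by (simp add: Bochner_Integration.integral_sum)
  finally show ?thesis .
qed

lemma gain_A:
  fixes D D' :: "real ^ 'k ^ 'n" and \<Theta> :: "(real ^ 'p) set"
  assumes A: "setting_A \<Theta> \<D> \<mu> F \<zeta> \<gamma> P U \<phi>" and Theta: "open \<Theta>"
    and mean_diff: "\<And>\<theta> d. \<theta> \<in> \<Theta> \<Longrightarrow> d \<in> \<D> \<Longrightarrow> (\<lambda>t. \<mu> t d) differentiable (at \<theta>)"
    and D: "D \<in> designs \<D>" and D': "D' \<in> designs \<D>"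
  shows "U D' - U D = (\<Sum>i\<in>UNIV. 1 * (\<phi> (D' $ i) - \<phi> (D $ i)))"
proof -
  have F: "exp_family_at F \<gamma>" and link: "mean_link F \<Theta> \<D> \<mu> \<zeta>" and P: "AE \<theta> in P. \<theta> \<in> \<Theta>"
    and U: "U = FIG_A F \<zeta> \<gamma> P" and \<phi>: "\<phi> = phi_A F \<mu> \<zeta> \<gamma> P"
    and J: "\<And>D. D \<in> (designs \<D> :: (real ^ 'k ^ 'n) set) \<Longrightarrow>
      integrable P (\<lambda>\<theta>. trace (fisher_information (ef_base F) (ef_likelihood F \<zeta> D \<gamma>) \<theta>))"
    and f: "\<And>d j. d \<in> \<D> \<Longrightarrow> integrable P (info_term F \<mu> \<zeta> \<gamma> d j)"
    using A unfolding setting_A_def prior_on_def by blast+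
  interpret mean_model F \<Theta> \<D> \<mu> \<zeta>
    by unfold_locales (fact Theta mean_diff link)+
  have d: "D $ i \<in> \<D>" "D' $ i \<in> \<D>" for i
    using D D' by (simp_all add: designs_def)
  show ?thesis
    unfolding U \<phi> FIG_A_def phi_A_def
  proof (rule expected_gain[OF J[OF D] J[OF D'] f[OF d(1)] f[OF d(2)]])
    show "AE \<theta> in P. trace (fisher_information (ef_base F) (ef_likelihood F \<zeta> D' \<gamma>) \<theta>) -
        trace (fisher_information (ef_base F) (ef_likelihood F \<zeta> D \<gamma>) \<theta>) =
      (\<Sum>i\<in>UNIV. 1 * ((\<Sum>j\<in>UNIV. info_term F \<mu> \<zeta> \<gamma> (D' $ i) j \<theta>) - (\<Sum>j\<in>UNIV. info_term F \<mu> \<zeta> \<gamma> (D $ i) j \<theta>)))"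
      using P by eventually_elim
        (simp add: trace_information_A[OF F _ D] trace_information_A[OF F _ D'] sum_subtractf)
  qed
qed

lemma gain_B:
  fixes D D' :: "real ^ 'k ^ 'n" and \<Theta> :: "(real ^ 'p) set"
  assumes B: "setting_B \<Theta> \<D> \<mu> F \<zeta> P U \<phi>" and Theta: "open \<Theta>"
    and mean_diff: "\<And>\<theta> d. \<theta> \<in> \<Theta> \<Longrightarrow> d \<in> \<D> \<Longrightarrow> (\<lambda>t. \<mu> t d) differentiable (at \<theta>)"
    and D: "D \<in> designs \<D>" and D': "D' \<in> designs \<D>"
  shows "U D' - U D = (\<Sum>i\<in>UNIV. 1 * (\<phi> (D' $ i) - \<phi> (D $ i)))"
proof -
  have F: "\<forall>\<gamma>>0. exp_family_at F \<gamma>" and link: "mean_link F \<Theta> \<D> \<mu> \<zeta>"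
    and P: "AE x in P. x \<in> \<Theta> \<times> {0<..}"
    and U: "U = FIG_B F \<zeta> P" and \<phi>: "\<phi> = phi_B F \<mu> \<zeta> P"
    and J: "\<And>D. D \<in> (designs \<D> :: (real ^ 'k ^ 'n) set) \<Longrightarrow> integrable P (\<lambda>(\<theta>, \<gamma>).
      trace (fisher_information (ef_base F) (joint_likelihood F \<zeta> D) (join_par \<theta> \<gamma>)))"
    and f: "\<And>d j. d \<in> \<D> \<Longrightarrow> integrable P (\<lambda>(\<theta>, \<gamma>). info_term F \<mu> \<zeta> \<gamma> d j \<theta>)"
    using B unfolding setting_B_def prior_on_def by blast+
  interpret mean_model F \<Theta> \<D> \<mu> \<zeta>
    by unfold_locales (fact Theta mean_diff link)+
  have d: "D $ i \<in> \<D>" "D' $ i \<in> \<D>" for i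
    using D D' by (simp_all add: designs_def)
  show ?thesis
    unfolding U \<phi> FIG_B_def phi_B_def
  proof (rule expected_gain[where f = "\<lambda>d j (\<theta>, \<gamma>). info_term F \<mu> \<zeta> \<gamma> d j \<theta>",
        OF J[OF D] J[OF D'] f[OF d(1)] f[OF d(2)]])
    show "AE x in P. (case x of (\<theta>, \<gamma>) \<Rightarrow> trace (fisher_information (ef_base F) (joint_likelihood F \<zeta> D') (join_par \<theta> \<gamma>))) -
        (case x of (\<theta>, \<gamma>) \<Rightarrow> trace (fisher_information (ef_base F) (joint_likelihood F \<zeta> D) (join_par \<theta> \<gamma>))) =
      (\<Sum>i\<in>UNIV. 1 * ((\<Sum>j\<in>UNIV. case x of (\<theta>, \<gamma>) \<Rightarrow> info_term F \<mu> \<zeta> \<gamma> (D' $ i) j \<theta>) -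
        (\<Sum>j\<in>UNIV. case x of (\<theta>, \<gamma>) \<Rightarrow> info_term F \<mu> \<zeta> \<gamma> (D $ i) j \<theta>)))"
      using P
    proof eventually_elim
      case (elim x)
      then obtain \<theta> \<gamma> where x: "x = (\<theta>, \<gamma>)" and \<theta>: "\<theta> \<in> \<Theta>" and \<gamma>: "\<gamma> > 0" by auto
      obtain K where "\<forall>D\<in>(designs \<D> :: (real ^ 'k ^ 'n) set).
          trace (fisher_information (ef_base F) (joint_likelihood F \<zeta> D) (join_par \<theta> \<gamma>)) =
          K + (\<Sum>i\<in>UNIV. \<Sum>j\<in>UNIV. info_term F \<mu> \<zeta> \<gamma> (D $ i) j \<theta>)"
        using trace_information_B[OF F \<gamma> \<theta>, where 'n = 'n] by blast
      thus ?case
        using D D' by (simp add: x sum_subtractf)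
    qed
  qed
qed

lemma gain_C:
  fixes \<mu> :: "real ^ 'p \<Rightarrow> real ^ 'k \<Rightarrow> real" and U :: "real ^ 'k ^ 'n \<Rightarrow> real"
  assumes C: "setting_C \<Theta> \<D> \<mu> s1 s2 P U \<phi>"
    and mean_diff: "\<And>\<theta> d. \<theta> \<in> \<Theta> \<Longrightarrow> d \<in> \<D> \<Longrightarrow> (\<lambda>t. \<mu> t d) differentiable (at \<theta>)"
  shows "\<exists>c. (\<forall>i. c i > 0) \<and> (\<forall>D\<in>designs \<D>. \<forall>D'\<in>designs \<D>.
    U D' - U D = (\<Sum>i\<in>UNIV. c i * (\<phi> (D' $ i) - \<phi> (D $ i))))"
proof -
  have s: "s1 > 0" "s2 > 0" and P: "AE \<theta> in P. \<theta> \<in> \<Theta>"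
    and U: "U = FIG_C \<mu> s1 s2 P" and \<phi>: "\<phi> = phi_C \<mu> P"
    and J: "\<And>D. D \<in> (designs \<D> :: (real ^ 'k ^ 'n) set) \<Longrightarrow>
      integrable P (\<lambda>\<theta>. trace (fisher_information normal_base (marginal_likelihood \<mu> s1 s2 D) \<theta>))"
    and f: "\<And>d j. d \<in> \<D> \<Longrightarrow> integrable P (\<lambda>\<theta>. (partial_deriv (\<lambda>t. \<mu> t d) j \<theta>)\<^sup>2)"
    using C unfolding setting_C_def prior_on_def by blast+
  obtain \<kappa> where \<kappa>: "\<forall>i. \<kappa> i > 0" and trace: "\<forall>(D :: real ^ 'k ^ 'n) \<theta>.
      (\<forall>i. (\<lambda>t. \<mu> t (D $ i)) differentiable (at \<theta>)) \<longrightarrow>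
      trace (fisher_information normal_base (marginal_likelihood \<mu> s1 s2 D) \<theta>) =
        (\<Sum>i\<in>UNIV. \<kappa> i * (\<Sum>j\<in>UNIV. (partial_deriv (\<lambda>t. \<mu> t (D $ i)) j \<theta>)\<^sup>2))"
    using trace_information_C[OF s, of \<mu>, where 'n = 'n] by (elim exE conjE)
  have "U D' - U D = (\<Sum>i\<in>UNIV. \<kappa> i * (\<phi> (D' $ i) - \<phi> (D $ i)))"
    if D: "D \<in> designs \<D>" and D': "D' \<in> designs \<D>" for D D'
  proof -
    have d: "D $ i \<in> \<D>" "D' $ i \<in> \<D>" for i
      using D D' by (simp_all add: designs_def)
    show ?thesis
      unfolding U \<phi> FIG_C_def phi_C_def
    proof (rule expected_gain[where f = "\<lambda>d j \<theta>. (partial_deriv (\<lambda>t. \<mu> t d) j \<theta>)\<^sup>2",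
          OF J[OF D] J[OF D'] f[OF d(1)] f[OF d(2)]])
      show "AE \<theta> in P. trace (fisher_information normal_base (marginal_likelihood \<mu> s1 s2 D') \<theta>) -
          trace (fisher_information normal_base (marginal_likelihood \<mu> s1 s2 D) \<theta>) =
        (\<Sum>i\<in>UNIV. \<kappa> i * ((\<Sum>j\<in>UNIV. (partial_deriv (\<lambda>t. \<mu> t (D' $ i)) j \<theta>)\<^sup>2) -
          (\<Sum>j\<in>UNIV. (partial_deriv (\<lambda>t. \<mu> t (D $ i)) j \<theta>)\<^sup>2)))"
        using P
      proof eventually_elim
        case (elim \<theta>)
        have "\<forall>i. (\<lambda>t. \<mu> t (D $ i)) differentiable (at \<theta>)" "\<forall>i. (\<lambda>t. \<mu> t (D' $ i)) differentiable (at \<theta>)"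
          using mean_diff[OF elim] d by blast+
        thus ?case
          by (simp only: trace[rule_format] sum_subtractf right_diff_distrib)
      qed
    qed
  qed
  with \<kappa> show ?thesis by blast
qed


section \<open>Support of optimal designs\<close>

theorem mainTheorem4:
  fixes \<D> :: "(real ^ 'k) set" and \<Theta> :: "(real ^ 'p) set"
    and \<mu> \<zeta> :: "real ^ 'p \<Rightarrow> real ^ 'k \<Rightarrow> real" and F :: exp_family
    and \<gamma> s1 s2 :: real
    and P :: "(real ^ 'p) measure" and P' :: "((real ^ 'p) \<times> real) measure"
    and U :: "real ^ 'k ^ 'n \<Rightarrow> real" and \<phi> :: "real ^ 'k \<Rightarrow> real"
    and q :: nat and D :: "real ^ 'k ^ 'n"
  assumes p_le_n: "CARD('p) \<le> CARD('n)"
    and Theta: "open \<Theta>"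
    and mean_diff: "\<And>\<theta> d. \<theta> \<in> \<Theta> \<Longrightarrow> d \<in> \<D> \<Longrightarrow> (\<lambda>t. \<mu> t d) differentiable (at \<theta>)"
    and setting: "setting_A \<Theta> \<D> \<mu> F \<zeta> \<gamma> P U \<phi> \<or> setting_B \<Theta> \<D> \<mu> F \<zeta> P' U \<phi> \<or>
      setting_C \<Theta> \<D> \<mu> s1 s2 P U \<phi>"
    and q: "finite (global_maximisers \<phi> \<D>)" "card (global_maximisers \<phi> \<D>) = q"
    and q_less: "q < CARD('p)"
    and optimal: "FIG_optimal U \<D> D"
  shows "card (support_points D) \<le> q \<and> under_supported CARD('p) D \<and>
    (\<forall>\<theta>\<in>\<Theta>.
       (\<forall>R \<subseteq> rows (model_matrix \<mu> \<theta> D). independent R \<longrightarrow> card R \<le> q) \<and>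
       rank (model_matrix \<mu> \<theta> D) < CARD('p) \<and>
       parameter_redundant \<mu> \<theta> D)"
proof -
  have "support_points D \<subseteq> global_maximisers \<phi> \<D>"
    using setting
  proof (elim disjE)
    assume "setting_A \<Theta> \<D> \<mu> F \<zeta> \<gamma> P U \<phi>"
    from gain_A[OF this Theta mean_diff] show ?thesis
      by (intro FIG_optimal_support_points[OF optimal, where c = "\<lambda>_. 1"]) auto
  next
    assume "setting_B \<Theta> \<D> \<mu> F \<zeta> P' U \<phi>"
    from gain_B[OF this Theta mean_diff] show ?thesis
      by (intro FIG_optimal_support_points[OF optimal, where c = "\<lambda>_. 1"]) auto
  next
    assume "setting_C \<Theta> \<D> \<mu> s1 s2 P U \<phi>"
    from gain_C[OF this mean_diff] obtain c where "\<forall>i. c i > 0"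
      "\<forall>D\<in>designs \<D>. \<forall>D'\<in>designs \<D>. U D' - U D = (\<Sum>i\<in>UNIV. c i * (\<phi> (D' $ i) - \<phi> (D $ i)))"
      by blast
    thus ?thesis
      by (intro FIG_optimal_support_points[OF optimal, where c = c]) blast+
  qed
  hence le: "card (support_points D) \<le> q"
    using card_mono[OF q(1)] q(2) by blast
  moreover have "rank (model_matrix \<mu> \<theta> D) < CARD('p)" for \<theta>
    using rank_model_matrix[of \<mu> \<theta> D] le q_less by linarith
  moreover have "card R \<le> q" if "R \<subseteq> rows (model_matrix \<mu> \<theta> D)" for R \<theta>
    using card_subset_rows_model_matrix[OF that] le by linarith
  ultimately show ?thesis
    using q_less by (auto simp: under_supported_def parameter_redundant_def)
qed

end
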